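(* Let $n$ be a positive integer with $n \ge 2$. Then the greatest possible size of the difference between two (not necessarily distinct) cycles on the $n \times n$ grid with the same signature is $n^2 - \delta_n$, where \[\delta_n = n^2 \bmod 8 = \begin{cases} 1 & \text{if } n \text{ is odd},\\ 0 & \text{if } n \equiv 0 \pmod 4,\\ 4 & \text{if } n \equiv 2 \pmod 4. \end{cases}\]
   Context: The $m \times n$ grid is the plane graph whose vertices are the integer points $(x, y)$ with $1 \le x \le m$ and $1 \le y \le n$ and whose edges are the unit segments between these points; its finite faces are the unit square cells. The signature of a cycle $C$ on the grid is the function assigning to each cell the number of edges of that cell which belong to $C$. The difference between two cycles is the set of all edges which are part of exactly one of the two cycles (the symmetric difference of their edge sets). The two cycles are allowed to coincide, so the greatest size is $0$ when no two distinct cycles share a signature. *)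

theory Defs
  imports Main "HOL-Library.FuncSet"
begin

type_synonym point = "int \<times> int"

definition grid_vertices :: "nat \<Rightarrow> nat \<Rightarrow> point set" where
  "grid_vertices m n = {1..int m} \<times> {1..int n}"

definition unit_apart :: "point \<Rightarrow> point \<Rightarrow> bool" where
  "unit_apart u v \<longleftrightarrow> \<bar>fst u - fst v\<bar> + \<bar>snd u - snd v\<bar> = 1"

definition grid_edges :: "nat \<Rightarrow> nat \<Rightarrow> point set set" where
  "grid_edges m n =
     {{u, v} | u v. u \<in> grid_vertices m n \<and> v \<in> grid_vertices m n \<and> unit_apart u v}"

(* A unit square cell is represented by its lower left corner. *)
definition grid_cells :: "nat \<Rightarrow> nat \<Rightarrow> point set" where
  "grid_cells m n = {1..<int m} \<times> {1..<int n}"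

fun cell_edges :: "point \<Rightarrow> point set set" where
  "cell_edges (x, y) =
     {{(x, y), (x + 1, y)}, {(x, y + 1), (x + 1, y + 1)},
      {(x, y), (x, y + 1)}, {(x + 1, y), (x + 1, y + 1)}}"

definition closed_walk_edges :: "'a list \<Rightarrow> 'a set set" where
  "closed_walk_edges p = {{p ! i, p ! (Suc i mod length p)} | i. i < length p}"

(* A cycle of a simple undirected graph with edge set E, identified with its own edge set C.
   At least three distinct vertices are required, so an edge walked back and forth is excluded. *)
definition is_cycle :: "'a set set \<Rightarrow> 'a set set \<Rightarrow> bool" where
  "is_cycle E C \<longleftrightarrow>
     (\<exists>p. 3 \<le> length p \<and> distinct p \<and> closed_walk_edges p \<subseteq> E \<and> C = closed_walk_edges p)"

(* Restricted to the cells of the grid: the unbounded face, and unit squares of the plane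
   outside the grid, do not count. *)
definition signature :: "nat \<Rightarrow> nat \<Rightarrow> point set set \<Rightarrow> point \<Rightarrow> nat" where
  "signature m n C = (\<lambda>c \<in> grid_cells m n. card (cell_edges c \<inter> C))"

definition difference_sizes :: "nat \<Rightarrow> nat \<Rightarrow> nat set" where
  "difference_sizes m n =
     {card (sym_diff C D) | C D.
        is_cycle (grid_edges m n) C \<and> is_cycle (grid_edges m n) D \<and>
        signature m n C = signature m n D}"

definition is_greatest :: "nat set \<Rightarrow> nat \<Rightarrow> bool" where
  "is_greatest S k \<longleftrightarrow> k \<in> S \<and> (\<forall>s \<in> S. s \<le> k)"

definition delta :: "nat \<Rightarrow> nat" where
  "delta n = n\<^sup>2 mod 8"

end

theory Submission
  imports Defs
begin

text \<open>
  \<^bold>\<open>Upper bound.\<close> A cycle separates the cells into an inside and an outside. Let \<open>w\<close> be the set of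
  cells on which two cycles with equal signatures disagree about this. Each cell has an even number
  of neighbours in \<open>w\<close>, which forces \<open>w (x, y) = Q (x + y) + Q (x - y)\<close> modulo 2 for some \<open>Q\<close> reflected
  at \<open>0\<close> and \<open>n\<close>; the difference is then the set of crossings of \<open>n\<close> closed billiard
  trajectories, some selected and some not, that involve exactly one selected trajectory. Any two
  trajectories cross four times, so with \<open>s\<close> selected ones the difference has size
  \<open>4 s (n - s) = n\<^sup>2 - \<sigma>\<^sup>2\<close>, where \<open>\<sigma> = 2 s - n\<close>. What remains is to exclude \<open>n = 2 s\<close> with \<open>s\<close> odd,
  by pairing the balance conditions with an explicit discrete harmonic weight.

  \<^bold>\<open>Construction.\<close> For even \<open>s\<close>, run \<open>s\<close> parallel staircases along the main diagonal and join their
  ends in pairs, symmetrically with respect to that diagonal. This cycle and its mirror image have the same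
  signature and differ exactly in the \<open>4 s (n - s)\<close> edges of the region swept by the staircases.
\<close>

section \<open>Edges of the square lattice\<close>

definition hedge :: "int \<Rightarrow> int \<Rightarrow> point set" where
  "hedge x y = {(x, y), (x + 1, y)}"

definition vedge :: "int \<Rightarrow> int \<Rightarrow> point set" where
  "vedge x y = {(x, y), (x, y + 1)}"

lemma hedge_eq_iff [simp]: "hedge x y = hedge x' y' \<longleftrightarrow> x = x' \<and> y = y'"
  by (auto simp: hedge_def doubleton_eq_iff)

lemma vedge_eq_iff [simp]: "vedge x y = vedge x' y' \<longleftrightarrow> x = x' \<and> y = y'"
  by (auto simp: vedge_def doubleton_eq_iff)

lemma hedge_neq_vedge [simp]: "hedge x y \<noteq> vedge x' y'" "vedge x' y' \<noteq> hedge x y"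
  by (auto simp: hedge_def vedge_def doubleton_eq_iff)

lemma mem_hedge: "(a, b) \<in> hedge x y \<longleftrightarrow> (a = x \<or> a = x + 1) \<and> b = y"
  by (auto simp: hedge_def)

lemma mem_vedge: "(a, b) \<in> vedge x y \<longleftrightarrow> a = x \<and> (b = y \<or> b = y + 1)"
  by (auto simp: vedge_def)

lemma cell_edges_eq:
  "cell_edges (x, y) = {hedge x y, hedge x (y + 1), vedge x y, vedge (x + 1) y}"
  by (simp add: hedge_def vedge_def)

lemma unit_apart_edge:
  assumes "unit_apart u v"
  obtains x y where "{u, v} = hedge x y" | x y where "{u, v} = vedge x y"
proof -
  obtain a b c d where uv: "u = (a, b)" "v = (c, d)" by fastforce
  have "\<bar>a - c\<bar> + \<bar>b - d\<bar> = 1" using assms by (simp add: uv unit_apart_def)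
  then consider "c = a + 1 \<and> d = b" | "a = c + 1 \<and> d = b" | "c = a \<and> d = b + 1" | "c = a \<and> b = d + 1"
    by linarith
  then show thesis
    by cases (use that in \<open>auto simp: uv hedge_def vedge_def insert_commute\<close>)
qed

lemma hedge_mem_grid [simp]:
  "hedge x y \<in> grid_edges m n \<longleftrightarrow> 1 \<le> x \<and> x < int m \<and> 1 \<le> y \<and> y \<le> int n"
proof
  assume "hedge x y \<in> grid_edges m n"
  then have "(x, y) \<in> grid_vertices m n \<and> (x + 1, y) \<in> grid_vertices m n"
    by (auto simp: grid_edges_def hedge_def doubleton_eq_iff)
  then show "1 \<le> x \<and> x < int m \<and> 1 \<le> y \<and> y \<le> int n"
    by (auto simp: grid_vertices_def)
next
  assume "1 \<le> x \<and> x < int m \<and> 1 \<le> y \<and> y \<le> int n"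
  then have "(x, y) \<in> grid_vertices m n \<and> (x + 1, y) \<in> grid_vertices m n \<and> unit_apart (x, y) (x + 1, y)"
    by (auto simp: grid_vertices_def unit_apart_def)
  then show "hedge x y \<in> grid_edges m n"
    unfolding grid_edges_def hedge_def by blast
qed

lemma vedge_mem_grid [simp]:
  "vedge x y \<in> grid_edges m n \<longleftrightarrow> 1 \<le> x \<and> x \<le> int m \<and> 1 \<le> y \<and> y < int n"
proof
  assume "vedge x y \<in> grid_edges m n"
  then have "(x, y) \<in> grid_vertices m n \<and> (x, y + 1) \<in> grid_vertices m n"
    by (auto simp: grid_edges_def vedge_def doubleton_eq_iff)
  then show "1 \<le> x \<and> x \<le> int m \<and> 1 \<le> y \<and> y < int n"
    by (auto simp: grid_vertices_def)
next
  assume "1 \<le> x \<and> x \<le> int m \<and> 1 \<le> y \<and> y < int n"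
  then have "(x, y) \<in> grid_vertices m n \<and> (x, y + 1) \<in> grid_vertices m n \<and> unit_apart (x, y) (x, y + 1)"
    by (auto simp: grid_vertices_def unit_apart_def)
  then show "vedge x y \<in> grid_edges m n"
    unfolding grid_edges_def vedge_def by blast
qed

lemma grid_edge_cases:
  assumes "e \<in> grid_edges m n"
  obtains x y where "e = hedge x y" | x y where "e = vedge x y"
  using assms unit_apart_edge unfolding grid_edges_def by blast

lemma grid_edges_eq:
  "grid_edges m n = case_prod hedge ` ({1..<int m} \<times> {1..int n}) \<union> case_prod vedge ` ({1..int m} \<times> {1..<int n})"
  (is "_ = ?R")
proof (intro equalityI subsetI)
  fix e assume e: "e \<in> grid_edges m n"
  then show "e \<in> ?R"
  proof (cases rule: grid_edge_cases)
    case (1 x y)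
    with e have "(x, y) \<in> {1..<int m} \<times> {1..int n}" by simp
    then show ?thesis using 1 by force
  next
    case (2 x y)
    with e have "(x, y) \<in> {1..int m} \<times> {1..<int n}" by simp
    then show ?thesis using 2 by force
  qed
qed auto

lemma finite_grid_edges [simp]: "finite (grid_edges m n)"
  by (simp add: grid_edges_eq)

lemma card_insert_Int:
  "finite S \<Longrightarrow> a \<notin> S \<Longrightarrow> card (insert a S \<inter> C) = of_bool (a \<in> C) + card (S \<inter> C)"
  by (simp add: Int_insert_left)

lemma card_cell_edges_Int:
  "card (cell_edges (x, y) \<inter> C) = of_bool (hedge x y \<in> C) + of_bool (hedge x (y + 1) \<in> C)
     + of_bool (vedge x y \<in> C) + of_bool (vedge (x + 1) y \<in> C)"
  unfolding cell_edges_eq by (simp add: card_insert_Int)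

lemma card_grid_subset:
  assumes "S \<subseteq> grid_edges m n"
  shows "int (card S) = (\<Sum>x\<in>{1..<int m}. \<Sum>y\<in>{1..int n}. of_bool (hedge x y \<in> S))
     + (\<Sum>x\<in>{1..int m}. \<Sum>y\<in>{1..<int n}. of_bool (vedge x y \<in> S))"
proof -
  let ?H = "{1..<int m} \<times> {1..int n}" and ?V = "{1..int m} \<times> {1..<int n}"
  let ?h = "{p \<in> ?H. case_prod hedge p \<in> S}" and ?v = "{p \<in> ?V. case_prod vedge p \<in> S}"
  have S: "S = case_prod hedge ` ?h \<union> case_prod vedge ` ?v"
    using assms unfolding grid_edges_eq by blast
  have "card S = card (case_prod hedge ` ?h) + card (case_prod vedge ` ?v)"
    by (subst S, rule card_Un_disjoint) auto
  also have "\<dots> = card ?h + card ?v"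
    by (subst (1 2) card_image) (auto simp: inj_on_def)
  finally have "int (card S) = int (card ?h) + int (card ?v)" by simp
  also have "int (card ?h) = (\<Sum>p\<in>?H. of_bool (case_prod hedge p \<in> S))"
    by (simp add: Collect_conj_eq Int_commute)
  also have "int (card ?v) = (\<Sum>p\<in>?V. of_bool (case_prod vedge p \<in> S))"
    by (simp add: Collect_conj_eq Int_commute)
  finally show ?thesis
    by (simp only: sum.cartesian_product case_prod_unfold)
qed

section \<open>A cycle separates inside from outside\<close>

text \<open>A visited vertex lies exactly on the edges to its cyclic predecessor \<open>a\<close>
  and successor \<open>b\<close>; length at least 3 keeps these two edges distinct.\<close>

lemma closed_walk_degree:
  assumes "distinct p" "3 \<le> length p"
  shows "even (card {e \<in> closed_walk_edges p. v \<in> e})"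
proof (cases "v \<in> set p")
  case False
  have "{e \<in> closed_walk_edges p. v \<in> e} = {}"
  proof -
    have "Suc i mod length p < length p" for i using assms(2) by (intro mod_less_divisor) auto
    then show ?thesis using False by (auto simp: closed_walk_edges_def)
  qed
  then show ?thesis by (simp only: card.empty dvd_0_right)
next
  case True
  let ?L = "length p"
  obtain k where k: "k < ?L" "v = p ! k" using True by (auto simp: in_set_conv_nth)
  define a where "a = (if k = 0 then ?L - 1 else k - 1)"
  define b where "b = (if k = ?L - 1 then 0 else Suc k)"
  have ab: "a < ?L" "b < ?L" "a \<noteq> b" "a \<noteq> k" "b \<noteq> k" using k assms(2) by (auto simp: a_def b_def)
  have sk: "Suc k mod ?L = b" using k assms(2) by (auto simp: b_def mod_Suc)
  have sa: "Suc i mod ?L = k \<longleftrightarrow> i = a" if "i < ?L" for i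
    using that k assms(2) by (auto simp: a_def mod_Suc)
  have nth: "p ! i = p ! j \<longleftrightarrow> i = j" if "i < ?L" "j < ?L" for i j
    using that assms(1) by (simp add: nth_eq_iff_index_eq)
  have "{e \<in> closed_walk_edges p. v \<in> e} = {{p ! k, p ! b}, {p ! a, p ! k}}"
  proof (intro equalityI subsetI)
    fix e assume "e \<in> {e \<in> closed_walk_edges p. v \<in> e}"
    then obtain i where i: "i < ?L" "e = {p ! i, p ! (Suc i mod ?L)}" "v \<in> e"
      by (auto simp: closed_walk_edges_def)
    have "Suc i mod ?L < ?L" using k(1) by (intro mod_less_divisor) linarith
    then have "k = i \<or> Suc i mod ?L = k" using i k nth by auto
    then have "i = k \<or> i = a" using sa i by blast
    then show "e \<in> {{p ! k, p ! b}, {p ! a, p ! k}}" using i sk sa by auto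
  next
    fix e assume "e \<in> {{p ! k, p ! b}, {p ! a, p ! k}}"
    moreover have "{p ! k, p ! b} \<in> closed_walk_edges p"
      unfolding closed_walk_edges_def using k sk by blast
    moreover have "{p ! a, p ! k} \<in> closed_walk_edges p"
      unfolding closed_walk_edges_def using ab sa by blast
    ultimately show "e \<in> {e \<in> closed_walk_edges p. v \<in> e}" using k by auto
  qed
  moreover have "{p ! k, p ! b} \<noteq> {p ! a, p ! k}"
    using ab k nth by (auto simp: doubleton_eq_iff)
  ultimately show ?thesis by simp
qed

lemma cycle_subset: "is_cycle E C \<Longrightarrow> C \<subseteq> E"
  by (auto simp: is_cycle_def)

text \<open>Evenness of the degree, spelled out for the four lattice edges at \<open>(x, y)\<close>.
  Edges that leave the grid are not in \<open>C\<close>, so border points need no separate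
  case.\<close>

lemma cycle_vertex_even:
  assumes "is_cycle (grid_edges m n) C"
  shows "even (of_bool (hedge x y \<in> C) + of_bool (hedge (x - 1) y \<in> C)
     + of_bool (vedge x y \<in> C) + of_bool (vedge x (y - 1) \<in> C) :: nat)"
proof -
  let ?N = "{hedge x y, hedge (x - 1) y, vedge x y, vedge x (y - 1)}"
  have "even (card {e \<in> C. (x, y) \<in> e})"
    using assms closed_walk_degree by (auto simp: is_cycle_def)
  moreover have "{e \<in> C. (x, y) \<in> e} = ?N \<inter> C"
  proof (intro equalityI subsetI)
    fix e assume "e \<in> {e \<in> C. (x, y) \<in> e}"
    then have e: "e \<in> grid_edges m n" "(x, y) \<in> e" "e \<in> C"
      using cycle_subset[OF assms] by auto
    from e(1) show "e \<in> ?N \<inter> C"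
      by (cases rule: grid_edge_cases) (use e in \<open>auto simp: mem_hedge mem_vedge\<close>)
  qed (auto simp: hedge_def vedge_def)
  moreover have "card (?N \<inter> C) = of_bool (hedge x y \<in> C) + of_bool (hedge (x - 1) y \<in> C)
     + of_bool (vedge x y \<in> C) + of_bool (vedge x (y - 1) \<in> C)"
    by (simp add: card_insert_Int)
  ultimately show ?thesis by metis
qed

text \<open>The cell \<open>(x, y)\<close> lies above \<open>hedge x y\<close> and to the right of \<open>vedge x y\<close>.\<close>

definition region_of :: "nat \<Rightarrow> point set set \<Rightarrow> (int \<Rightarrow> int \<Rightarrow> bool) \<Rightarrow> bool" where
  "region_of n C r \<longleftrightarrow>
     (\<forall>x y. hedge x y \<in> C \<longleftrightarrow> r x y \<noteq> r x (y - 1)) \<and>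
     (\<forall>x y. vedge x y \<in> C \<longleftrightarrow> r x y \<noteq> r (x - 1) y) \<and>
     (\<forall>x y. r x y \<longrightarrow> 0 < x \<and> x < int n \<and> 0 < y \<and> y < int n)"

text \<open>Ray casting: \<open>r x y\<close> is the parity of the number of cycle edges at or below
  the bottom of the cell in its column. The rule for horizontal edges is then immediate, and the
  rule for vertical edges climbs from row to row by the evenness of degrees.\<close>

lemma cycle_region:
  assumes C: "is_cycle (grid_edges n n) C"
  obtains r where "region_of n C r"
proof -
  define r where "r x y = odd (\<Sum>k\<in>{1..y}. of_bool (hedge x k \<in> C) :: nat)" for x y
  have CE: "C \<subseteq> grid_edges n n" by (rule cycle_subset[OF C])
  have hC: "hedge x y \<in> C \<Longrightarrow> 1 \<le> x \<and> x < int n \<and> 1 \<le> y \<and> y \<le> int n" for x y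
    using CE hedge_mem_grid by blast
  have vC: "vedge x y \<in> C \<Longrightarrow> 1 \<le> x \<and> x \<le> int n \<and> 1 \<le> y \<and> y < int n" for x y
    using CE vedge_mem_grid by blast
  have h: "hedge x y \<in> C \<longleftrightarrow> r x y \<noteq> r x (y - 1)" for x y
  proof (cases "1 \<le> y")
    case True
    then have "{1..y} = insert y {1..y - 1}" by auto
    then show ?thesis by (simp add: r_def del: sum_of_bool_eq)
  next
    case False
    then show ?thesis using hC[of x y] by (auto simp: r_def)
  qed
  have r0: "\<not> r x y" if "y \<le> 0" for x y using that by (simp add: r_def)
  have v0: "vedge x y \<in> C \<longleftrightarrow> r x y \<noteq> r (x - 1) y" if "0 \<le> y" for x y
    using that
  proof (induction y rule: int_ge_induct)
    case base
    then show ?case using vC[of x 0] r0 by auto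
  next
    case (step y)
    show ?case
      using cycle_vertex_even[OF C, of x "y + 1"] step.IH h[of x "y + 1"] h[of "x - 1" "y + 1"]
      by (auto split: if_splits simp: of_bool_def)
  qed
  have v: "vedge x y \<in> C \<longleftrightarrow> r x y \<noteq> r (x - 1) y" for x y
    using v0[of y x] vC[of x y] r0[of y] by (cases "0 \<le> y") auto
  have rx: "\<not> r x y" if "x \<le> 0 \<or> int n \<le> x" for x y
  proof -
    have "hedge x k \<notin> C" for k using that hC[of x k] by auto
    then show ?thesis by (simp add: r_def)
  qed
  \<comment> \<open>No vertical edge of \<open>C\<close> lies at this height, so \<open>r\<close>
    keeps along the row the value it has in the empty column \<open>0\<close>.\<close>
  have ry: "\<not> r x y" if y: "int n \<le> y" for x y
  proof (cases "0 \<le> x")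
    case True
    then show ?thesis
    proof (induction x rule: int_ge_induct)
      case base
      then show ?case using rx by simp
    next
      case (step x)
      then show ?case using v[of "x + 1" y] vC[of "x + 1" y] y by auto
    qed
  qed (use rx in auto)
  have "region_of n C r"
    unfolding region_of_def using h v r0 rx ry by (meson not_le)
  then show thesis by (rule that)
qed

section \<open>The difference of two cycles with the same signature\<close>

lemma sum_int_Suc: "sum f {1..int (Suc n)} = sum f {1..int n} + (f (int n + 1) :: 'a::comm_monoid_add)"
proof -
  have "{1..int (Suc n)} = insert (int n + 1) {1..int n}" by auto
  then show ?thesis by (simp add: add.commute)
qed

section \<open>Signs and sums of reflected sequences\<close>

definition pm :: "bool \<Rightarrow> int" where "pm b = (if b then 1 else - 1)"

lemma pm_simps [simp]: "pm True = 1" "pm False = - 1" by (simp_all add: pm_def)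

lemma pm_neq_0 [simp]: "pm b \<noteq> 0" by (simp add: pm_def)

text \<open>The arguments descend from \<open>m\<close> in steps of two to \<open>2 - m\<close>. The
  reflection \<open>k -> 1 - k\<close> sends the nonpositive ones to the values in
  \<open>1..m\<close> that were skipped.\<close>

lemma sum_reflected_argument:
  fixes e :: "int \<Rightarrow> int"
  assumes e: "\<And>k. e (1 - k) = e k"
  shows "(\<Sum>x\<in>{1..int m}. e (2 * x - int m)) = sum e {1..int m}"
proof (induction m rule: induct_nat_012)
  case (ge2 m)
  let ?f = "\<lambda>x. e (2 * x - int (Suc (Suc m)))"
  have "{1..int (Suc (Suc m))} = insert 1 (insert (int m + 2) {2..int m + 1})" by auto
  then have "sum ?f {1..int (Suc (Suc m))} = e (- int m) + (e (int m + 2) + sum ?f {2..int m + 1})"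
    by (simp add: add.commute)
  also have "sum ?f {2..int m + 1} = (\<Sum>x\<in>{1..int m}. e (2 * x - int m))"
    by (rule sum.reindex_bij_witness[of _ "\<lambda>x. x + 1" "\<lambda>x. x - 1"]) (auto simp: algebra_simps)
  also have "\<dots> = sum e {1..int m}" by (rule ge2.IH)
  also have "e (- int m) = e (int m + 1)" using e[of "int m + 1"] by simp
  finally show ?case unfolding sum_int_Suc by (simp add: algebra_simps)
qed simp_all

text \<open>Each product \<open>e j * e k\<close> with \<open>j < k\<close> of the expanded square
  occurs once in the triangle: passing from \<open>n\<close> to \<open>n + 1\<close> adds the
  antidiagonal \<open>x + y = n + 1\<close>, whose second factors are rearranged by
  \<open>sum_reflected_argument\<close>.\<close>

lemma triangle_sum:
  fixes e :: "int \<Rightarrow> int"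
  assumes e: "\<And>k. e (1 - k) = e k"
  shows "2 * (\<Sum>x\<in>{1..int n}. \<Sum>y\<in>{1..int n - x}. e (x + y) * e (x - y + 1)) + (\<Sum>k\<in>{1..int n}. (e k)\<^sup>2)
    = (sum e {1..int n})\<^sup>2"
proof (induction n)
  case (Suc n)
  let ?g = "\<lambda>x y. e (x + y) * e (x - y + 1)"
  have "(\<Sum>y\<in>{1..int (Suc n) - x}. ?g x y) = (\<Sum>y\<in>{1..int n - x}. ?g x y) + e (int n + 1) * e (2 * x - int n)"
    if "x \<in> {1..int n}" for x
  proof -
    have "{1..int (Suc n) - x} = insert (int n + 1 - x) {1..int n - x}" using that by auto
    then show ?thesis by (simp add: algebra_simps)
  qed
  then have "(\<Sum>x\<in>{1..int n}. \<Sum>y\<in>{1..int (Suc n) - x}. ?g x y)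
    = (\<Sum>x\<in>{1..int n}. \<Sum>y\<in>{1..int n - x}. ?g x y) + e (int n + 1) * sum e {1..int n}"
    by (simp add: sum.distrib sum_distrib_left[symmetric] sum_reflected_argument[where e = e, OF e])
  then have "(\<Sum>x\<in>{1..int (Suc n)}. \<Sum>y\<in>{1..int (Suc n) - x}. ?g x y)
    = (\<Sum>x\<in>{1..int n}. \<Sum>y\<in>{1..int n - x}. ?g x y) + e (int n + 1) * sum e {1..int n}"
    by (subst sum_int_Suc) simp
  then show ?case
    using Suc.IH unfolding sum_int_Suc by (simp add: power2_eq_square algebra_simps)
qed simp

text \<open>The rectangle splits into two triangles exchanged by the half-turn
  \<open>(x, y) -> (n - x, n + 1 - y)\<close>. It reflects both arguments of the product, so each
  triangle contributes the sum in \<open>triangle_sum\<close>.\<close>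

lemma square_sum:
  fixes e :: "int \<Rightarrow> int"
  assumes e: "\<And>k. e (1 - k) = e k"
    and e': "\<And>k. 1 \<le> k \<Longrightarrow> k \<le> 2 * int n \<Longrightarrow> e (2 * int n + 1 - k) = e k"
  shows "(\<Sum>x\<in>{1..<int n}. \<Sum>y\<in>{1..int n}. e (x + y) * e (x - y + 1)) + (\<Sum>k\<in>{1..int n}. (e k)\<^sup>2)
    = (sum e {1..int n})\<^sup>2"
proof -
  let ?g = "\<lambda>x y. e (x + y) * e (x - y + 1)"
  let ?T = "\<Sum>x\<in>{1..<int n}. \<Sum>y\<in>{1..int n - x}. ?g x y"
  have "(\<Sum>y\<in>{1..int n}. ?g x y) = (\<Sum>y\<in>{1..int n - x}. ?g x y) + (\<Sum>y\<in>{int n - x + 1..int n}. ?g x y)"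
    if "x \<in> {1..<int n}" for x
  proof -
    have "{1..int n} = {1..int n - x} \<union> {int n - x + 1..int n}" using that by auto
    then show ?thesis by (simp add: sum.union_disjoint)
  qed
  then have "(\<Sum>x\<in>{1..<int n}. \<Sum>y\<in>{1..int n}. ?g x y) = ?T + (\<Sum>x\<in>{1..<int n}. \<Sum>y\<in>{int n - x + 1..int n}. ?g x y)"
    by (simp add: sum.distrib)
  also have "(\<Sum>x\<in>{1..<int n}. \<Sum>y\<in>{int n - x + 1..int n}. ?g x y) = ?T"
  proof (rule sum.reindex_bij_witness[of _ "\<lambda>x. int n - x" "\<lambda>x. int n - x"])
    fix x assume x: "x \<in> {1..<int n}"
    show "(\<Sum>y\<in>{1..int n - (int n - x)}. ?g (int n - x) y) = (\<Sum>y\<in>{int n - x + 1..int n}. ?g x y)"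
    proof (rule sum.reindex_bij_witness[of _ "\<lambda>y. int n + 1 - y" "\<lambda>y. int n + 1 - y"])
      fix y assume "y \<in> {1..int n - (int n - x)}"
      then show "?g x (int n + 1 - y) = ?g (int n - x) y"
        using x e'[of "int n - x + y"] e[of "x + y - int n"] by (simp add: algebra_simps)
    qed auto
  qed auto
  also have "?T = (\<Sum>x\<in>{1..int n}. \<Sum>y\<in>{1..int n - x}. ?g x y)"
    by (rule sum.mono_neutral_left) auto
  finally show ?thesis using triangle_sum[where e = e, OF e, of n] by simp
qed

text \<open>One-dimensional discrete Green identity; the sum telescopes to its boundary
  terms.\<close>

lemma green:
  fixes y z :: "int \<Rightarrow> 'a::comm_ring"
  shows "(\<Sum>i\<in>{1..int m}. y i * (z (i + 1) + z (i - 1)) - z i * (y (i + 1) + y (i - 1)))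
    = y (int m) * z (int m + 1) - y (int m + 1) * z (int m) + y 1 * z 0 - y 0 * z 1"
proof (induction m)
  case (Suc m)
  then show ?case unfolding sum_int_Suc by (simp add: algebra_simps)
qed simp

lemma sum_telescope2:
  fixes f :: "int \<Rightarrow> 'a::ab_group_add"
  shows "(\<Sum>i\<in>{1..int m}. f (i + 1) - f (i - 1)) = f (int m + 1) + f (int m) - f 1 - f 0"
proof (induction m)
  case (Suc m)
  then show ?case unfolding sum_int_Suc by (simp add: algebra_simps)
qed simp

lemma delta_eq: "delta n = (if odd n then 1 else if n mod 4 = 0 then 0 else 4)"
proof -
  \<comment> \<open>Modulo 8 a square depends only on the residue of its base modulo 4.\<close>
  obtain r k where n: "n = r + 4 * k" "r < 4"
    by (metis mod_less_divisor mod_mult_div_eq zero_less_numeral)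
  then have "n\<^sup>2 = r\<^sup>2 + 8 * (k * r + 2 * k\<^sup>2)"
    by (simp add: power2_eq_square algebra_simps)
  then have "n\<^sup>2 mod 8 = r\<^sup>2 mod 8" by (simp only: mod_mult_self2)
  then have "n\<^sup>2 mod 8 = (n mod 4)\<^sup>2 mod 8" using n by simp
  moreover have "n mod 4 \<in> {0, 1, 2, 3}" by auto
  moreover have "even (n mod 4) \<longleftrightarrow> even n" by presburger
  ultimately show ?thesis by (auto simp: delta_def)
qed

section \<open>The cells on which two cycles with equal signatures disagree\<close>

locale same_signature =
  fixes n :: nat and C D :: "point set set" and r r' :: "int \<Rightarrow> int \<Rightarrow> bool"
  assumes n: "2 \<le> n"
    and C: "C \<subseteq> grid_edges n n" and D: "D \<subseteq> grid_edges n n"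
    and r: "region_of n C r" and r': "region_of n D r'"
    and sig: "signature n n C = signature n n D"
begin

definition w :: "int \<Rightarrow> int \<Rightarrow> bool" where "w x y \<longleftrightarrow> r x y \<noteq> r' x y"

lemma w_outside: "x \<le> 0 \<or> int n \<le> x \<or> y \<le> 0 \<or> int n \<le> y \<Longrightarrow> \<not> w x y"
  using r r' unfolding w_def region_of_def by (meson not_le)

lemma r_outside: "x \<le> 0 \<or> int n \<le> x \<or> y \<le> 0 \<or> int n \<le> y \<Longrightarrow> \<not> r x y"
  using r unfolding region_of_def by (meson not_le)

lemma hedge_diff: "hedge x y \<in> sym_diff C D \<longleftrightarrow> w x y \<noteq> w x (y - 1)"
  using r r' unfolding w_def region_of_def by blast

lemma vedge_diff: "vedge x y \<in> sym_diff C D \<longleftrightarrow> w x y \<noteq> w (x - 1) y"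
  using r r' unfolding w_def region_of_def by blast

text \<open>The edge towards a neighbour \<open>(a, b)\<close> counts differently for
  \<open>C\<close> and \<open>D\<close> only if \<open>w\<close> separates the two cells, and then
  the counts differ by \<open>- pm (r x y) * pm (r a b)\<close>. Equal signatures make these terms
  add up to 0, and the common factor cancels.\<close>

lemma balance:
  assumes "0 < x" "x < int n" "0 < y" "y < int n"
  shows "(\<Sum>(a, b)\<leftarrow>[(x + 1, y), (x - 1, y), (x, y + 1), (x, y - 1)].
     of_bool (w a b \<noteq> w x y) * pm (r a b)) = 0"
    (is "?S = 0")
proof -
  have "(x, y) \<in> grid_cells n n" using assms by (auto simp: grid_cells_def)
  then have "card (cell_edges (x, y) \<inter> C) = card (cell_edges (x, y) \<inter> D)"
    using fun_cong[OF sig, of "(x, y)"] unfolding signature_def by simp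
  then have *: "(of_bool (hedge x y \<in> C) + of_bool (hedge x (y + 1) \<in> C)
     + of_bool (vedge x y \<in> C) + of_bool (vedge (x + 1) y \<in> C) :: nat)
     = of_bool (hedge x y \<in> D) + of_bool (hedge x (y + 1) \<in> D)
     + of_bool (vedge x y \<in> D) + of_bool (vedge (x + 1) y \<in> D)"
    unfolding card_cell_edges_Int .
  have h: "hedge a b \<in> C \<longleftrightarrow> r a b \<noteq> r a (b - 1)" "hedge a b \<in> D \<longleftrightarrow> r' a b \<noteq> r' a (b - 1)"
    "vedge a b \<in> C \<longleftrightarrow> r a b \<noteq> r (a - 1) b" "vedge a b \<in> D \<longleftrightarrow> r' a b \<noteq> r' (a - 1) b" for a b
    using r r' unfolding region_of_def by blast+
  have e: "int (of_bool (r a b \<noteq> r x y)) - int (of_bool (r' a b \<noteq> r' x y))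
      = - pm (r x y) * (of_bool (w a b \<noteq> w x y) * pm (r a b))" for a b
    unfolding w_def pm_def by simp
  have "pm (r x y) * ?S = 0"
    using arg_cong[OF *, of int] e[of "x + 1" y] e[of "x - 1" y] e[of x "y + 1"] e[of x "y - 1"]
    unfolding h by (simp add: algebra_simps eq_commute[of "r x y"] eq_commute[of "r' x y"] del: of_nat_of_bool)
  then show ?thesis by (simp only: mult_eq_0_iff pm_neq_0 simp_thms)
qed

text \<open>This is \<open>balance\<close> modulo 2: signs are odd, so an even number of the four
  neighbours differ from \<open>(x, y)\<close> in \<open>w\<close>, hence an even number lie in
  \<open>w\<close>.\<close>

lemma w_parity:
  assumes "0 < x" "x < int n" "0 < y" "y < int n"
  shows "w (x + 1) y \<longleftrightarrow> (w (x - 1) y \<noteq> (w x (y + 1) \<noteq> w x (y - 1)))"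
proof -
  have "even (of_bool b * pm s) \<longleftrightarrow> \<not> b" for b s
    by (simp add: pm_def)
  then show ?thesis
    using arg_cong[OF balance[OF assms], of even] by simp argo
qed

text \<open>Membership in \<open>w\<close> satisfies a discrete wave equation modulo 2, hence splits into a
  function of \<open>x + y\<close> and one of \<open>x - y\<close>; the vanishing of \<open>w\<close> outside the grid makes both
  the same function \<open>Q\<close>, reflected at \<open>0\<close> and at \<open>n\<close>.\<close>

fun Q0 :: "nat \<Rightarrow> bool" where
  "Q0 0 = False"
| "Q0 (Suc 0) = False"
| "Q0 (Suc (Suc k)) \<longleftrightarrow> Q0 k \<noteq> w 1 (int k + 1)"

text \<open>The argument is folded into \<open>0..n\<close> by reflections at \<open>0\<close> and
  \<open>n\<close>. This covers the range from \<open>- 2 * n\<close> to \<open>2 * n\<close>;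
  beyond it, \<open>nat\<close> truncates to \<open>0\<close>.\<close>

definition Q :: "int \<Rightarrow> bool" where "Q k = Q0 (nat (int n - \<bar>int n - \<bar>k\<bar>\<bar>))"

lemma Q_minus [simp]: "Q (- k) = Q k"
  by (simp add: Q_def)

lemma Q_reflect: "0 \<le> k \<Longrightarrow> k \<le> 2 * int n \<Longrightarrow> Q (2 * int n - k) = Q k"
  unfolding Q_def by (rule arg_cong[where f = "\<lambda>i. Q0 (nat i)"]) linarith

lemma Q_0 [simp]: "\<not> Q 0" and Q_1 [simp]: "\<not> Q 1"
  using n by (simp_all add: Q_def)

lemma Q_step: "0 < j \<Longrightarrow> j < int n \<Longrightarrow> Q (j + 1) \<longleftrightarrow> Q (j - 1) \<noteq> w 1 j"
proof -
  assume j: "0 < j" "j < int n"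
  define k where "k = nat (j - 1)"
  have k: "j = int k + 1" using j by (simp add: k_def)
  have "nat (int n - \<bar>int n - \<bar>j + 1\<bar>\<bar>) = Suc (Suc k)" "nat (int n - \<bar>int n - \<bar>j - 1\<bar>\<bar>) = k"
    using j k by linarith+
  then have "Q (j + 1) = Q0 (Suc (Suc k))" "Q (j - 1) = Q0 k"
    unfolding Q_def by presburger+
  then show ?thesis by (simp add: k)
qed

text \<open>Induction on the column: column \<open>0\<close> is empty, column \<open>1\<close>
  restates the recursion behind \<open>Q\<close>, and later columns follow from
  \<open>w_parity\<close>. On the border rows the reflections of \<open>Q\<close> make the right
  side false.\<close>

lemma w_eq_Q:
  assumes "0 \<le> i" "i \<le> int n" "0 \<le> j" "j \<le> int n"
  shows "w i j \<longleftrightarrow> Q (i + j) \<noteq> Q (i - j)"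
proof -
  have edge: "w i j \<longleftrightarrow> Q (i + j) \<noteq> Q (i - j)"
    if "0 \<le> i" "i \<le> int n" "j = 0 \<or> j = int n" for i j
  proof -
    have "\<not> w i j" using that(3) by (intro w_outside) auto
    moreover have "Q (i + j) = Q (i - j)"
      using that Q_reflect[of "int n - i"] Q_minus[of "int n - i"] by (auto simp: algebra_simps)
    ultimately show ?thesis by simp
  qed
  have "\<forall>j. 0 \<le> j \<longrightarrow> j \<le> int n \<longrightarrow> int k \<le> int n \<longrightarrow>
      (w (int k) j \<longleftrightarrow> Q (int k + j) \<noteq> Q (int k - j))" for k
  proof (induction k rule: induct_nat_012)
    case 0
    have "\<not> w 0 j" for j by (intro w_outside) auto
    then show ?case by simp
  next
    case 1
    show ?case
    proof (intro allI impI)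
      fix j assume j: "0 \<le> j" "j \<le> int n" "int (Suc 0) \<le> int n"
      show "w (int (Suc 0)) j \<longleftrightarrow> Q (int (Suc 0) + j) \<noteq> Q (int (Suc 0) - j)"
      proof (cases "0 < j \<and> j < int n")
        case True
        then show ?thesis
          using Q_step[of j] Q_minus[of "1 - j"] by (auto simp: algebra_simps)
      next
        case False
        then show ?thesis using j edge[of "int (Suc 0)" j] by auto
      qed
    qed
  next
    case (ge2 k)
    show ?case
    proof (intro allI impI)
      fix j assume j: "0 \<le> j" "j \<le> int n" "int (Suc (Suc k)) \<le> int n"
      show "w (int (Suc (Suc k))) j \<longleftrightarrow> Q (int (Suc (Suc k)) + j) \<noteq> Q (int (Suc (Suc k)) - j)"
      proof (cases "0 < j \<and> j < int n")
        case True
        define i where "i = int k + 1"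
        have i: "int (Suc (Suc k)) = i + 1" "int (Suc k) = i" "int k = i - 1" "0 < i" "i < int n"
          using j by (simp_all add: i_def)
        have a: "w (i - 1) j \<longleftrightarrow> Q (i - 1 + j) \<noteq> Q (i - 1 - j)"
          using ge2.IH(1) i True by simp
        have b: "w i j' \<longleftrightarrow> Q (i + j') \<noteq> Q (i - j')" if "0 \<le> j'" "j' \<le> int n" for j'
          using ge2.IH(2) i that by simp
        \<comment> \<open>In the three values on the right, \<open>Q (i - 1 + j)\<close> and
          \<open>Q (i - 1 - j)\<close> each occur twice and cancel.\<close>
        have "w (i + 1) j \<longleftrightarrow> (w (i - 1) j \<noteq> (w i (j + 1) \<noteq> w i (j - 1)))"
          using w_parity i True by blast
        moreover have "i + (j + 1) = i + 1 + j" "i - (j + 1) = i - 1 - j" "i + (j - 1) = i - 1 + j"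
          "i - (j - 1) = i + 1 - j" by simp_all
        ultimately show ?thesis
          unfolding i a using b[of "j + 1"] b[of "j - 1"] True by auto
      next
        case False
        then show ?thesis using j edge[of "int (Suc (Suc k))" j] by auto
      qed
    qed
  qed
  from this[of "nat i"] show ?thesis using assms by simp
qed


section \<open>The size of the difference\<close>

definition eps :: "int \<Rightarrow> int" where "eps k = pm (Q k \<noteq> Q (k - 1))"

text \<open>With \<open>s\<close> indices at which \<open>Q\<close> changes, the selected
  trajectories, this is \<open>2 s - n\<close>.\<close>

definition sigma :: int where "sigma = sum eps {1..int n}"

lemma eps_refl0: "eps (1 - k) = eps k"
  using Q_minus[of k] Q_minus[of "k - 1"] by (auto simp: eps_def simp del: Q_minus)

lemma eps_refl: "1 \<le> k \<Longrightarrow> k \<le> 2 * int n \<Longrightarrow> eps (2 * int n + 1 - k) = eps k"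
  using Q_reflect[of k] Q_reflect[of "k - 1"] by (auto simp: eps_def algebra_simps)

lemma eps_sq [simp]: "(eps k)\<^sup>2 = 1"
  by (simp add: eps_def pm_def)

text \<open>An edge lies in the difference exactly when the product of the two \<open>eps\<close>
  values belonging to its diagonals is \<open>-1\<close>. The indicator is therefore affine in this
  product, and \<open>square_sum\<close> evaluates the total.\<close>

lemma card_diff: "int (card (sym_diff C D)) = (int n)\<^sup>2 - sigma\<^sup>2"
proof -
  let ?g = "\<lambda>x y. eps (x + y) * eps (x - y + 1)"
  have pm_xor: "2 * of_bool ((a \<noteq> b) \<noteq> (c \<noteq> d)) = 1 - pm (a \<noteq> c) * pm (b \<noteq> d)" for a b c d :: bool
    by (cases a; cases b; cases c; cases d) simp_all
  have h: "2 * of_bool (hedge x y \<in> sym_diff C D) = 1 - ?g x y"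
    if "x \<in> {1..<int n}" "y \<in> {1..int n}" for x y
  proof -
    have "hedge x y \<in> sym_diff C D \<longleftrightarrow> (Q (x + y) \<noteq> Q (x - y)) \<noteq> (Q (x + y - 1) \<noteq> Q (x - y + 1))"
      unfolding hedge_diff using that w_eq_Q[of x y] w_eq_Q[of x "y - 1"]
      by (simp add: algebra_simps)
    then show ?thesis
      unfolding eps_def by (simp only: pm_xor) (simp add: eq_commute)
  qed
  \<comment> \<open>Coordinates are swapped so that vertical edges have the same summand as
    horizontal ones.\<close>
  have v: "2 * of_bool (vedge y x \<in> sym_diff C D) = 1 - ?g x y"
    if "x \<in> {1..<int n}" "y \<in> {1..int n}" for x y
  proof -
    have "vedge y x \<in> sym_diff C D \<longleftrightarrow> (Q (x + y) \<noteq> Q (x - y)) \<noteq> (Q (x + y - 1) \<noteq> Q (x - y + 1))"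
      unfolding vedge_diff using that w_eq_Q[of y x] w_eq_Q[of "y - 1" x] Q_minus[of "y - x"]
        Q_minus[of "y - 1 - x"]
      by (simp add: algebra_simps)
    then show ?thesis
      unfolding eps_def by (simp only: pm_xor) (simp add: eq_commute)
  qed
  have "2 * int (card (sym_diff C D))
      = (\<Sum>x\<in>{1..<int n}. \<Sum>y\<in>{1..int n}. 2 * of_bool (hedge x y \<in> sym_diff C D))
      + (\<Sum>x\<in>{1..<int n}. \<Sum>y\<in>{1..int n}. 2 * of_bool (vedge y x \<in> sym_diff C D))"
    using C D by (subst card_grid_subset[of _ n n], blast, subst (2) sum.swap)
      (simp only: sum_distrib_left distrib_left)
  also have "\<dots> = 2 * (\<Sum>x\<in>{1..<int n}. \<Sum>y\<in>{1..int n}. 1 - ?g x y)"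
    using h v by simp
  also have "\<dots> = 2 * (int n * (int n - 1) - (\<Sum>x\<in>{1..<int n}. \<Sum>y\<in>{1..int n}. ?g x y))"
    using n by (simp add: sum_subtractf)
  also have "(\<Sum>x\<in>{1..<int n}. \<Sum>y\<in>{1..int n}. ?g x y) = sigma\<^sup>2 - int n"
    using square_sum[of eps n, OF eps_refl0 eps_refl] by (simp add: sigma_def)
  finally show ?thesis by (simp add: power2_eq_square algebra_simps)
qed

text \<open>The left sum is twice the number of changes of \<open>Q\<close> on the way from
  \<open>0\<close> to \<open>m\<close>; since \<open>Q 0\<close> is false, \<open>Q m\<close>
  records the parity of that number.\<close>

lemma sum_eps_mod_4: "(sum eps {1..int m} + int m) mod 4 = (if Q (int m) then 2 else 0)"
proof (induction m)
  case (Suc m)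
  have "(sum eps {1..int (Suc m)} + int (Suc m)) mod 4
      = ((sum eps {1..int m} + int m) mod 4 + (eps (int m + 1) + 1)) mod 4"
    unfolding sum_int_Suc mod_add_left_eq by (simp add: algebra_simps)
  then show ?case unfolding Suc.IH by (simp add: eps_def add.commute)
qed simp

text \<open>The weight \<open>Y\<close> below is supported on \<open>w\<close> and is harmonic (its four neighbours add up to
  0), while the signs \<open>r\<close> outside \<open>w\<close> add up to 0 around each cell of \<open>w\<close>. Green's identity
  leaves only a boundary term, which would be nonzero if \<open>Q n\<close> held.\<close>

lemma not_Q_n:
  assumes even: "even n"
  shows "\<not> Q (int n)"
proof
  assume Qn: "Q (int n)"
  define q :: "int \<Rightarrow> int" where "q k = of_bool (Q k)" for k
  define sg :: "int \<Rightarrow> int" where "sg i = (if even i then 1 else - 1)" for i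
  define Y where "Y i j = sg i * (q (i + j) - q (i - j))" for i j
  define Z where "Z i j = of_bool (\<not> w i j) * pm (r i j)" for i j
  define m where "m = n - 1"
  have m: "int n = int m + 1" using n by (simp add: m_def)
  have sg: "sg (i + 1) = - sg i" "sg (1 + i) = - sg i" "sg (i - 1) = - sg i" for i by (auto simp: sg_def)
  have q_minus: "q (- k) = q k" for k by (simp add: q_def)
  have q_reflect: "q (2 * int n - k) = q k" if "0 \<le> k" "k \<le> 2 * int n" for k
    using that by (simp add: q_def Q_reflect)
  \<comment> \<open>Over the integers \<open>q (i + j) - q (i - j)\<close> satisfies the wave
    equation; the alternating sign \<open>sg i\<close> turns it into harmonicity.\<close>
  have harm: "Y (i + 1) j + Y (i - 1) j + (Y i (j + 1) + Y i (j - 1)) = 0" for i j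
    by (simp add: Y_def sg algebra_simps)
  \<comment> \<open>On \<open>w\<close> the bracket vanishes by \<open>balance\<close>, off
    \<open>w\<close> the factor \<open>Y i j\<close> does.\<close>
  have bal: "Y i j * (Z (i + 1) j + Z (i - 1) j + (Z i (j + 1) + Z i (j - 1))) = 0"
    if "i \<in> {1..int m}" "j \<in> {1..int m}" for i j
  proof (cases "w i j")
    case True
    then show ?thesis using balance[of i j] that m by (simp add: Z_def)
  next
    case False
    then have "Y i j = 0" using w_eq_Q[of i j] that m by (simp add: Y_def q_def)
    then show ?thesis by simp
  qed
  have Y0: "Y 0 j = 0" "Y j 0 = 0" for j
    using q_minus[of j] by (simp_all add: Y_def)
  have Yn: "Y (int n) j = 0" "Y j (int n) = 0" if "j \<in> {1..int m}" for j
    using that m q_reflect[of "int n - j"] q_minus[of "int n - j"] by (simp_all add: Y_def algebra_simps)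
  \<comment> \<open>The surrounding cells lie outside both \<open>w\<close> and \<open>C\<close>, so
    only border values of \<open>Y\<close> survive in the boundary terms.\<close>
  have Zout: "Z 0 j = - 1" "Z j 0 = - 1" "Z (int n) j = - 1" "Z j (int n) = - 1" for j
    using w_outside r_outside by (simp_all add: Z_def)
  let ?gi = "\<lambda>i j. Y i j * (Z (i + 1) j + Z (i - 1) j) - Z i j * (Y (i + 1) j + Y (i - 1) j)"
  let ?gj = "\<lambda>i j. Y i j * (Z i (j + 1) + Z i (j - 1)) - Z i j * (Y i (j + 1) + Y i (j - 1))"
  have zero: "?gi i j + ?gj i j = 0" if "i \<in> {1..int m}" "j \<in> {1..int m}" for i j
  proof -
    have "?gi i j + ?gj i j = Y i j * (Z (i + 1) j + Z (i - 1) j + (Z i (j + 1) + Z i (j - 1)))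
      - Z i j * (Y (i + 1) j + Y (i - 1) j + (Y i (j + 1) + Y i (j - 1)))"
      by (simp add: algebra_simps)
    then show ?thesis by (simp only: bal[OF that] harm)
  qed
  have gi: "(\<Sum>i\<in>{1..int m}. ?gi i j) = - Y (int m) j - Y 1 j" if "j \<in> {1..int m}" for j
    using green[of "\<lambda>i. Y i j" "\<lambda>i. Z i j" m] unfolding m[symmetric] by (simp add: Yn[OF that] Y0 Zout)
  have gj: "(\<Sum>j\<in>{1..int m}. ?gj i j) = - Y i (int m) - Y i 1" if "i \<in> {1..int m}" for i
    using green[of "Y i" "Z i" m] unfolding m[symmetric] by (simp add: Yn[OF that] Y0 Zout)
  have "(\<Sum>i\<in>{1..int m}. \<Sum>j\<in>{1..int m}. ?gi i j) + (\<Sum>i\<in>{1..int m}. \<Sum>j\<in>{1..int m}. ?gj i j)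
      = (\<Sum>i\<in>{1..int m}. \<Sum>j\<in>{1..int m}. ?gi i j + ?gj i j)"
    by (simp only: sum.distrib)
  also have "\<dots> = 0" using zero by simp
  also have "(\<Sum>i\<in>{1..int m}. \<Sum>j\<in>{1..int m}. ?gi i j) = (\<Sum>j\<in>{1..int m}. - Y (int m) j - Y 1 j)"
    by (subst sum.swap) (simp only: gi cong: sum.cong)
  also have "(\<Sum>i\<in>{1..int m}. \<Sum>j\<in>{1..int m}. ?gj i j) = (\<Sum>i\<in>{1..int m}. - Y i (int m) - Y i 1)"
    by (simp only: gj cong: sum.cong)
  finally have sum0: "(\<Sum>j\<in>{1..int m}. Y (int m) j) + (\<Sum>j\<in>{1..int m}. Y 1 j)
      + (\<Sum>i\<in>{1..int m}. Y i (int m)) + (\<Sum>i\<in>{1..int m}. Y i 1) = 0"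
    by (simp add: sum_subtractf sum_negf)
  define A where "A = (\<Sum>i\<in>{1..int m}. q (i + 1) - q (i - 1))"
  define B where "B = (\<Sum>i\<in>{1..int m}. sg i * (q (i + 1) - q (i - 1)))"
  \<comment> \<open>Parity enters here: it makes opposite borders contribute equally,
    \<open>- A\<close> for both extreme columns and \<open>B\<close> for both extreme rows, instead
    of cancelling.\<close>
  have odd_m: "odd m" using even n by (simp add: m_def)
  have 1: "(\<Sum>j\<in>{1..int m}. Y 1 j) = - A"
    unfolding A_def sum_negf[symmetric]
  proof (intro sum.cong refl)
    fix j show "Y 1 j = - (q (j + 1) - q (j - 1))"
      using q_minus[of "j - 1"] by (simp add: Y_def sg_def add.commute)
  qed
  have 2: "(\<Sum>j\<in>{1..int m}. Y (int m) j) = - A"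
    unfolding A_def sum_negf[symmetric]
  proof (rule sum.reindex_bij_witness[of _ "\<lambda>j. int n - j" "\<lambda>j. int n - j"])
    fix j assume "j \<in> {1..int m}"
    then show "- (q (int n - j + 1) - q (int n - j - 1)) = Y (int m) j"
      using q_reflect[of "int m + j"] m odd_m by (simp add: Y_def sg_def algebra_simps)
  qed (use m in auto)
  have 3: "(\<Sum>i\<in>{1..int m}. Y i 1) = B"
    by (simp add: B_def Y_def)
  have 4: "(\<Sum>i\<in>{1..int m}. Y i (int m)) = B"
    unfolding B_def
  proof (rule sum.reindex_bij_witness[of _ "\<lambda>j. int n - j" "\<lambda>j. int n - j"])
    fix i assume "i \<in> {1..int m}"
    then show "sg (int n - i) * (q (int n - i + 1) - q (int n - i - 1)) = Y i (int m)"
      using q_reflect[of "int m + i"] q_minus[of "int m - i"] m even odd_m by (simp add: Y_def sg_def algebra_simps)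
  qed (use m in auto)
  have q01: "q 0 = 0" "q 1 = 0" by (simp_all add: q_def)
  have A: "A = q (int n) + q (int m)"
    using sum_telescope2[of q m] by (simp add: A_def q01 m)
  have "B = - (\<Sum>i\<in>{1..int m}. sg (i + 1) * q (i + 1) - sg (i - 1) * q (i - 1))"
    unfolding B_def sum_negf[symmetric] by (intro sum.cong refl) (simp add: sg algebra_simps)
  also have "\<dots> = - (q (int n) - q (int m))"
    using sum_telescope2[of "\<lambda>i. sg i * q i" m] odd_m by (simp add: q01 m sg_def)
  \<comment> \<open>The total \<open>2 * B - 2 * A\<close> equals \<open>- 4 * q n\<close>, as the
    terms \<open>q m\<close> cancel.\<close>
  finally have "4 * q (int n) = 0" using sum0 A unfolding 1 2 3 4 by simp
  then show False using Qn by (simp add: q_def)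
qed

text \<open>The residue of \<open>sigma + n\<close> modulo 4 bounds \<open>sigma\<close> away from
  0: for odd \<open>n\<close>, \<open>sigma\<close> is odd; for \<open>n\<close> congruent to 2
  modulo 4, \<open>not_Q_n\<close> makes \<open>sigma\<close> congruent to 2 as well.\<close>

lemma card_diff_le: "card (sym_diff C D) \<le> n\<^sup>2 - delta n"
proof -
  have mod: "(sigma + int n) mod 4 = (if Q (int n) then 2 else 0)"
    using sum_eps_mod_4[of n] by (simp add: sigma_def)
  have "int (delta n) \<le> sigma\<^sup>2"
  proof (cases "odd n")
    case True
    have "even ((sigma + int n) mod 4)" using mod by simp
    then have "odd sigma" using True by (simp add: even_iff_mod_2_eq_zero mod_mod_cancel) presburger
    then have "sigma \<noteq> 0" by auto
    then have "0 < sigma\<^sup>2" by simp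
    then have "1 \<le> sigma\<^sup>2" by linarith
    then show ?thesis using True by (simp add: delta_eq)
  next
    case False
    show ?thesis
    proof (cases "n mod 4 = 0")
      case n4: False
      have 0: "(sigma + int n) mod 4 = 0" using mod not_Q_n False by simp
      have 2: "int n mod 4 = 2" using False n4 by presburger
      have "(a + b) mod 4 = 0 \<Longrightarrow> b mod 4 = 2 \<Longrightarrow> a mod 4 = 2" for a b :: int
        by presburger
      from this[OF 0 2] have "sigma mod 4 = 2" .
      then have "sigma \<noteq> 0 \<and> sigma \<noteq> 1 \<and> sigma \<noteq> - 1" by auto
      then have "\<bar>2\<bar> \<le> \<bar>sigma\<bar>" by linarith
      then have "2\<^sup>2 \<le> sigma\<^sup>2" by (rule abs_le_square_iff[THEN iffD1])
      then show ?thesis using False n4 by (simp add: delta_eq)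
    qed (use False in \<open>simp add: delta_eq\<close>)
  qed
  then have "int (card (sym_diff C D)) \<le> int (n\<^sup>2) - int (delta n)"
    using card_diff by simp
  then show ?thesis by linarith
qed

end

section \<open>Closed walks as lists\<close>

text \<open>Edges of an open walk, in recursive form so that a tour can be assembled by
  concatenating pieces.\<close>

fun path_edges :: "'a list \<Rightarrow> 'a set set" where
  "path_edges (x # y # zs) = insert {x, y} (path_edges (y # zs))"
| "path_edges _ = {}"

lemma path_edges_append:
  assumes "xs \<noteq> []" "ys \<noteq> []"
  shows "path_edges (xs @ ys) = path_edges xs \<union> {{last xs, hd ys}} \<union> path_edges ys"
  using assms(1)
proof (induction xs)
  case (Cons x xs)
  show ?case
  proof (cases xs)
    case Nil
    then show ?thesis using assms(2) by (cases ys) auto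
  next
    case (Cons y zs)
    then show ?thesis using \<open>xs \<noteq> [] \<Longrightarrow> _\<close> by (simp add: insert_commute)
  qed
qed simp

lemma path_edges_Cons: "ys \<noteq> [] \<Longrightarrow> path_edges (x # ys) = insert {x, hd ys} (path_edges ys)"
  by (cases ys) auto

lemma path_edges_rev [simp]: "path_edges (rev xs) = path_edges xs"
proof (induction xs rule: path_edges.induct)
  case (1 x y zs)
  have "path_edges (rev (x # y # zs)) = path_edges (rev (y # zs) @ [x])" by simp
  also have "\<dots> = path_edges (rev (y # zs)) \<union> {{last (rev (y # zs)), x}}"
    by (subst path_edges_append) auto
  finally show ?case using 1 by (auto simp: insert_commute)
qed auto

lemma path_edges_nth: "path_edges xs = {{xs ! i, xs ! Suc i} | i. Suc i < length xs}"
proof (induction xs rule: path_edges.induct)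
  case (1 x y zs)
  have "{{(x # y # zs) ! i, (x # y # zs) ! Suc i} | i. Suc i < length (x # y # zs)}
     = insert {x, y} {{(y # zs) ! i, (y # zs) ! Suc i} | i. Suc i < length (y # zs)}" (is "?L = ?R")
  proof (intro equalityI subsetI)
    fix e assume "e \<in> ?L"
    then obtain i where i: "e = {(x # y # zs) ! i, (x # y # zs) ! Suc i}" "Suc i < length (x # y # zs)"
      by blast
    show "e \<in> ?R"
    proof (cases i)
      case (Suc j)
      then have "e = {(y # zs) ! j, (y # zs) ! Suc j} \<and> Suc j < length (y # zs)" using i by simp
      then show ?thesis by blast
    qed (use i in simp)
  next
    fix e assume "e \<in> ?R"
    then consider "e = {x, y}"
      | j where "e = {(y # zs) ! j, (y # zs) ! Suc j}" "Suc j < length (y # zs)" by blast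
    then show "e \<in> ?L"
    proof cases
      case 1
      then have "e = {(x # y # zs) ! 0, (x # y # zs) ! Suc 0} \<and> Suc 0 < length (x # y # zs)" by simp
      then show ?thesis by blast
    next
      case (2 j)
      then have "e = {(x # y # zs) ! Suc j, (x # y # zs) ! Suc (Suc j)} \<and> Suc (Suc j) < length (x # y # zs)" by simp
      then show ?thesis by blast
    qed
  qed
  then show ?case using 1 by simp
qed auto

lemma path_edges_map_upt:
  "path_edges (map f [a..<b]) = (\<lambda>j. {f j, f (Suc j)}) ` {a..<b - 1}"
proof -
  have "{{map f [a..<b] ! i, map f [a..<b] ! Suc i} | i. Suc i < b - a} = (\<lambda>j. {f j, f (Suc j)}) ` {a..<b - 1}" (is "?L = ?R")
  proof (intro equalityI subsetI)
    fix e assume "e \<in> ?L"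
    then obtain i where "e = {f (a + i), f (Suc (a + i))}" "Suc i < b - a" by auto
    moreover from this have "a + i \<in> {a..<b - 1}" by auto
    ultimately show "e \<in> ?R" by blast
  next
    fix e assume "e \<in> ?R"
    then obtain j where j: "e = {f j, f (Suc j)}" "a \<le> j" "j < b - 1" by auto
    then have "e = {map f [a..<b] ! (j - a), map f [a..<b] ! Suc (j - a)}" "Suc (j - a) < b - a" by auto
    then show "e \<in> ?L" by blast
  qed
  then show ?thesis unfolding path_edges_nth by simp
qed

lemma closed_walk_edges_image:
  "closed_walk_edges p = (\<lambda>i. {p ! i, p ! (Suc i mod length p)}) ` {..<length p}"
  by (auto simp: closed_walk_edges_def)

text \<open>Repeating the first vertex at the end replaces the wrap-around of indices.\<close>

lemma closed_walk_edges_path: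
  assumes "p \<noteq> []"
  shows "closed_walk_edges p = path_edges (p @ [hd p])"
proof -
  have "{(p @ [hd p]) ! i, (p @ [hd p]) ! Suc i} = {p ! i, p ! (Suc i mod length p)}" if "i < length p" for i
    using that assms by (cases "Suc i = length p") (auto simp: nth_append hd_conv_nth)
  then have "(\<lambda>i. {p ! i, p ! (Suc i mod length p)}) ` {..<length p}
      = (\<lambda>i. {(p @ [hd p]) ! i, (p @ [hd p]) ! Suc i}) ` {..<length p}"
    by (intro image_cong refl) auto
  then show ?thesis
    unfolding closed_walk_edges_def path_edges_nth by (simp add: image_def lessThan_def Bex_def conj_commute)
qed

text \<open>Serves to turn the constructed cycle into its mirror image; the map is applied to the
  vertex list.\<close>

lemma is_cycle_image:
  assumes "is_cycle E C" "inj f" "(`) f ` E \<subseteq> E"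
  shows "is_cycle E ((`) f ` C)"
proof -
  obtain p where p: "3 \<le> length p" "distinct p" "closed_walk_edges p \<subseteq> E" "C = closed_walk_edges p"
    using assms(1) by (auto simp: is_cycle_def)
  have "closed_walk_edges (map f p) = (`) f ` closed_walk_edges p"
  proof -
    have "{map f p ! i, map f p ! (Suc i mod length p)} = f ` {p ! i, p ! (Suc i mod length p)}"
      if "i < length p" for i
    proof -
      have "Suc i mod length p < length p" using p(1) by (intro mod_less_divisor) linarith
      then show ?thesis using that by simp
    qed
    then show ?thesis
      unfolding closed_walk_edges_image image_image by (intro image_cong) simp_all
  qed
  moreover have "distinct (map f p)" using p(2) inj_on_subset[OF assms(2)] by (simp add: distinct_map)
  moreover have "(`) f ` closed_walk_edges p \<subseteq> E" using p(3) assms(3) by blast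
  ultimately show ?thesis
    unfolding is_cycle_def using p by (intro exI[of _ "map f p"]) simp
qed

section \<open>Two extremal cycles\<close>

text \<open>\<open>rho j\<close> and \<open>mu j\<close> count the steps to the right and upwards
  among the first \<open>j\<close> steps of the staircase right, up, up, right, repeated.\<close>

primrec rho :: "nat \<Rightarrow> nat" where
  "rho 0 = 0"
| "rho (Suc j) = (if j mod 4 \<in> {0, 3} then Suc (rho j) else rho j)"

primrec mu :: "nat \<Rightarrow> nat" where
  "mu 0 = 0"
| "mu (Suc j) = (if j mod 4 \<in> {0, 3} then mu j else Suc (mu j))"

lemma rho_mu: "rho j + mu j = j"
  by (induction j) auto

text \<open>The surplus of right steps runs through 1, 0, -1, 0, so a strand stays within one unit
  of a diagonal.\<close>

lemma rho_mu_diff: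
  "int (rho j) - int (mu j) = (if j mod 4 = 1 then 1 else if j mod 4 = 3 then - 1 else 0)"
proof (induction j)
  case (Suc j)
  have "j mod 4 \<in> {0, 1, 2, 3}" by auto
  then show ?case using Suc by (auto simp: mod_Suc)
qed simp

lemma rho_mu_double [simp]: "rho (2 * k) = k" "mu (2 * k) = k"
proof -
  have "2 * k mod 4 \<noteq> 1" "2 * k mod 4 \<noteq> 3" by presburger+
  then have "int (rho (2 * k)) = int (mu (2 * k))" using rho_mu_diff[of "2 * k"] by simp
  then show "rho (2 * k) = k" "mu (2 * k) = k" using rho_mu[of "2 * k"] by linarith+
qed

lemma image_insert_Times: "case_prod f ` (insert a A \<times> B) = f a ` B \<union> case_prod f ` (A \<times> B)"
  by force

text \<open>The strand \<open>i\<close> is a staircase running up along the main diagonal, with steps right, up, up,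
  right, repeated. Consecutive strands are joined by caps alternately at the lower left corner of
  the grid (\<open>ll\<close>) and at its upper right corner (\<open>ur\<close>), and the last strand is joined to the
  first one along the upper right part of the boundary (\<open>out\<close>).\<close>

locale extremal =
  fixes n m :: nat
  assumes m: "1 \<le> m" "2 * m \<le> n"
begin

text \<open>Number of steps of a strand, which leads from level \<open>x + y = 2 * m + 1\<close> to
  level \<open>2 * n - 2 * m + 1\<close>. For \<open>n = 2\<close>, \<open>m = 1\<close> it is 0 and
  strands are single points.\<close>

definition N :: nat where "N = 2 * (n - 2 * m)"

definition pos :: "nat \<Rightarrow> nat \<Rightarrow> point" where
  "pos i j = (int i + 1 + int (rho j), 2 * int m - int i + int (mu j))"
text \<open>\<open>ll i\<close> is just below the start of strand \<open>2 * i\<close> and just left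
  of the start of the next one; \<open>ur i\<close> is just right of the end of strand
  \<open>2 * i + 1\<close> and just above the end of the next one.\<close>

definition ll :: "nat \<Rightarrow> point" where
  "ll i = (2 * int i + 1, 2 * int m - 2 * int i - 1)"
definition ur :: "nat \<Rightarrow> point" where
  "ur i = (int n - 2 * int m + 2 * int i + 3, int n - 2 * int i - 1)"
definition out :: "nat \<Rightarrow> point" where
  "out j = (if j < 2 * m then (int n, int n - 2 * int m + 1 + int j)
     else (int n + 2 * int m - 1 - int j, int n))"

definition strand :: "nat \<Rightarrow> point list" where "strand i = map (pos i) [0..<Suc N]"
definition seg :: "nat \<Rightarrow> point list" where
  "seg i = rev (strand (2 * i)) @ ll i # strand (2 * i + 1)"
primrec body :: "nat \<Rightarrow> point list" where
  "body 0 = seg 0"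
| "body (Suc k) = body k @ ur k # seg (Suc k)"
text \<open>The points \<open>out 0\<close> and \<open>out (4 * m - 2)\<close> are left out because
  they are the last and the first vertex of the body.\<close>

definition tour :: "point list" where "tour = body (m - 1) @ map out [1..<4 * m - 2]"

lemma int_N: "int N = 2 * int n - 4 * int m"
  using m by (simp add: N_def)

lemma pos_N: "pos i N = (int n - 2 * int m + int i + 1, int n - int i)"
  using m by (simp add: N_def pos_def)

text \<open>Every step raises the level \<open>x + y\<close> by one. The level separates the strands
  from \<open>ll\<close> below and from \<open>ur\<close> and the inner points of \<open>out\<close>
  above.\<close>

lemma pos_level: "fst (pos i j) + snd (pos i j) = 2 * int m + 1 + int j"
  using rho_mu[of j] by (simp add: pos_def)

lemma pos_eq_iff [simp]: "pos i j = pos i' j' \<longleftrightarrow> i = i' \<and> j = j'"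
proof
  assume *: "pos i j = pos i' j'"
  then have "j = j'" using pos_level[of i j] pos_level[of i' j'] by simp
  then show "i = i' \<and> j = j'" using * by (simp add: pos_def)
qed simp

lemma ll_eq_iff [simp]: "ll i = ll i' \<longleftrightarrow> i = i'" and ur_eq_iff [simp]: "ur i = ur i' \<longleftrightarrow> i = i'"
  by (auto simp: ll_def ur_def)

lemma pos_neq_ll [simp]: "pos i j \<noteq> ll k" "ll k \<noteq> pos i j"
proof -
  show "pos i j \<noteq> ll k"
  proof
    assume "pos i j = ll k"
    then show False using pos_level[of i j] by (simp add: ll_def)
  qed
  then show "ll k \<noteq> pos i j" by metis
qed

lemma pos_neq_ur [simp]:
  assumes "j \<le> N"
  shows "pos i j \<noteq> ur k" "ur k \<noteq> pos i j"
proof -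
  show "pos i j \<noteq> ur k"
  proof
    assume "pos i j = ur k"
    then show False using pos_level[of i j] int_N assms by (simp add: ur_def)
  qed
  then show "ur k \<noteq> pos i j" by metis
qed

lemma ll_neq_ur [simp]: "ll i \<noteq> ur k" "ur k \<noteq> ll i"
  using m by (auto simp: ll_def ur_def)

lemma out_level: "1 \<le> j \<Longrightarrow> j < 4 * m - 2 \<Longrightarrow> fst (out j) + snd (out j) \<ge> 2 * int n - 2 * int m + 2"
  by (auto simp: out_def)

lemma out_neq_pos: "1 \<le> j \<Longrightarrow> j < 4 * m - 2 \<Longrightarrow> j' \<le> N \<Longrightarrow> out j \<noteq> pos i j'"
  using pos_level[of i j'] out_level[of j] int_N by auto

lemma out_neq_ll: "1 \<le> j \<Longrightarrow> j < 4 * m - 2 \<Longrightarrow> out j \<noteq> ll i"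
  using out_level[of j] m by (auto simp: ll_def)

lemma out_neq_ur: "k < m - 1 \<Longrightarrow> out j \<noteq> ur k"
  by (auto simp: out_def ur_def)

lemma inj_out: "inj out"
  by (rule injI) (auto simp: out_def split: if_splits)

lemma set_strand: "set (strand i) = pos i ` {..N}"
  by (auto simp: strand_def)

lemma distinct_strand: "distinct (strand i)"
  by (simp add: strand_def distinct_map inj_on_def del: upt_Suc)

lemma set_seg: "set (seg i) = pos (2 * i) ` {..N} \<union> {ll i} \<union> pos (2 * i + 1) ` {..N}"
  by (auto simp: seg_def set_strand)

lemma distinct_seg: "distinct (seg i)"
  by (auto simp: seg_def distinct_strand set_strand)

lemma set_body: "set (body k) = case_prod pos ` ({..<2 * k + 2} \<times> {..N}) \<union> ll ` {..k} \<union> ur ` {..<k}"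
proof (induction k)
  case 0
  have "{..<2 * 0 + 2} = {0, 1 :: nat}" by auto
  then show ?case
    by (simp only: body.simps set_seg image_insert_Times) (simp add: atMost_0)
next
  case (Suc k)
  have "{..<2 * Suc k + 2} = insert (2 * Suc k) (insert (2 * Suc k + 1) {..<2 * k + 2})" by auto
  then have "case_prod pos ` ({..<2 * Suc k + 2} \<times> {..N})
    = pos (2 * Suc k) ` {..N} \<union> (pos (2 * Suc k + 1) ` {..N} \<union> case_prod pos ` ({..<2 * k + 2} \<times> {..N}))"
    by (simp only: image_insert_Times)
  then show ?case
    by (simp only: body.simps set_append list.set set_seg Suc.IH atMost_Suc lessThan_Suc image_insert) blast
qed

lemma distinct_body: "distinct (body k)"
proof (induction k)
  case 0
  then show ?case by (simp add: distinct_seg)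
next
  case (Suc k)
  have "ur k \<notin> set (body k)" "ur k \<notin> set (seg (Suc k))"
    by (auto simp: set_body set_seg)
  moreover have "set (body k) \<inter> set (seg (Suc k)) = {}"
    by (auto simp: set_body set_seg)
  ultimately show ?case using Suc.IH distinct_seg by simp
qed

lemma distinct_tour: "distinct tour"
proof -
  have "set (body (m - 1)) \<inter> out ` {1..<4 * m - 2} = {}"
    using out_neq_pos out_neq_ll out_neq_ur by (fastforce simp: set_body)
  then show ?thesis
    using inj_on_subset[OF inj_out] by (simp add: tour_def distinct_body distinct_map)
qed

section \<open>The edge set of the tour\<close>

definition P :: "point set set" where
  "P = (\<lambda>(i, j). {pos i j, pos i (Suc j)}) ` ({..<2 * m} \<times> {..<N})"

text \<open>The connecting edges through \<open>ll\<close>, \<open>ur\<close> and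
  \<open>out\<close>, in coordinates; the cycle and its mirror image share them.\<close>

definition K :: "point set set" where
  "K = (\<Union>i<m. {vedge (2 * int i + 1) (2 * int m - 2 * int i - 1), hedge (2 * int i + 1) (2 * int m - 2 * int i - 1)})
     \<union> (\<Union>i<m - 1. {hedge (int n - 2 * int m + 2 * int i + 2) (int n - 2 * int i - 1),
                   vedge (int n - 2 * int m + 2 * int i + 3) (int n - 2 * int i - 2)})
     \<union> (\<Union>t\<in>{int n - 2 * int m + 1..<int n}. {vedge (int n) t, hedge t (int n)})"

lemma strand_nonempty [simp]: "strand i \<noteq> []"
  by (simp add: strand_def)

lemma hd_strand [simp]: "hd (strand i) = pos i 0"
  by (simp add: strand_def hd_map del: upt_Suc)

lemma last_strand [simp]: "last (strand i) = pos i N"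
  by (simp add: strand_def)

lemma seg_nonempty [simp]: "seg i \<noteq> []" and hd_seg: "hd (seg i) = pos (2 * i) N"
  and last_seg: "last (seg i) = pos (2 * i + 1) N"
  by (simp_all add: seg_def hd_append hd_rev)

lemma body_nonempty [simp]: "body k \<noteq> []" and hd_body: "hd (body k) = pos 0 N"
  and last_body: "last (body k) = pos (2 * k + 1) N"
  by (induction k) (simp_all add: hd_seg last_seg)

lemma path_edges_seg:
  "path_edges (seg i) = path_edges (strand (2 * i)) \<union> path_edges (strand (2 * i + 1))
     \<union> {{pos (2 * i) 0, ll i}, {ll i, pos (2 * i + 1) 0}}"
proof -
  have "path_edges (seg i) = path_edges (strand (2 * i)) \<union> {{pos (2 * i) 0, ll i}}
      \<union> insert {ll i, pos (2 * i + 1) 0} (path_edges (strand (2 * i + 1)))"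
    unfolding seg_def by (subst path_edges_append) (simp_all add: path_edges_Cons last_rev)
  then show ?thesis by blast
qed

lemma path_edges_body:
  "path_edges (body k) = (\<Union>i<2 * k + 2. path_edges (strand i))
     \<union> (\<Union>i<k + 1. {{pos (2 * i) 0, ll i}, {ll i, pos (2 * i + 1) 0}})
     \<union> (\<Union>i<k. {{pos (2 * i + 1) N, ur i}, {ur i, pos (2 * i + 2) N}})"
proof (induction k)
  case 0
  have "{..<2 * 0 + 2} = {0, 1 :: nat}" "{..<0 + 1} = {0 :: nat}" by auto
  then show ?case
    by (simp only: body.simps path_edges_seg) simp
next
  case (Suc k)
  have "path_edges (body (Suc k)) = path_edges (body k @ ([ur k] @ seg (Suc k)))" by simp
  also have "\<dots> = path_edges (body k) \<union> {{pos (2 * k + 1) N, ur k}} \<union> {{ur k, pos (2 * k + 2) N}} \<union> path_edges (seg (Suc k))"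
    by (subst path_edges_append, simp, simp, subst path_edges_append) (auto simp: last_body hd_seg)
  finally have step: "path_edges (body (Suc k)) = path_edges (body k) \<union> {{pos (2 * k + 1) N, ur k}}
    \<union> {{ur k, pos (2 * k + 2) N}} \<union> path_edges (seg (Suc k))" .
  have sets: "{..<2 * Suc k + 2} = insert (2 * Suc k) (insert (2 * Suc k + 1) {..<2 * k + 2})"
    "{..<Suc k + 1} = insert (Suc k) {..<k + 1}" "{..<Suc k} = insert k {..<k}" by auto
  have "A \<union> B \<union> C \<union> {a} \<union> {b} \<union> (S \<union> T \<union> {c, d}) = (S \<union> (T \<union> A)) \<union> ({c, d} \<union> B) \<union> ({a, b} \<union> C)"
    for A B C S T and a b c d :: "point set" by blast
  then show ?case
    unfolding step Suc.IH path_edges_seg sets UN_insert .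
qed

lemma out_edges:
  "(\<lambda>j. {out j, out (Suc j)}) ` {0..<4 * m - 2}
    = (\<Union>t\<in>{int n - 2 * int m + 1..<int n}. {vedge (int n) t, hedge t (int n)})" (is "?L = ?R")
proof (intro equalityI subsetI)
  fix e assume "e \<in> ?L"
  then obtain j where j: "e = {out j, out (Suc j)}" "j < 4 * m - 2" by auto
  show "e \<in> ?R"
  proof (cases "Suc j < 2 * m")
    case True
    then have "e = vedge (int n) (int n - 2 * int m + 1 + int j)"
      using j by (simp add: out_def vedge_def algebra_simps)
    then show ?thesis using True by force
  next
    case False
    then have "e = hedge (int n + 2 * int m - 2 - int j) (int n)"
      using j by (cases "Suc j = 2 * m") (auto simp: out_def hedge_def insert_commute algebra_simps)
    moreover have "int n + 2 * int m - 2 - int j \<in> {int n - 2 * int m + 1..<int n}" using False j by auto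
    ultimately show ?thesis by blast
  qed
next
  fix e assume "e \<in> ?R"
  then obtain t where t: "int n - 2 * int m + 1 \<le> t" "t < int n" "e = vedge (int n) t \<or> e = hedge t (int n)" by auto
  from t(3) show "e \<in> ?L"
  proof
    assume e: "e = vedge (int n) t"
    define j where "j = nat (t - (int n - 2 * int m + 1))"
    have j: "t = int n - 2 * int m + 1 + int j" using t by (simp add: j_def)
    then have "e = {out j, out (Suc j)}" "j \<in> {0..<4 * m - 2}"
      using t e by (auto simp: out_def vedge_def algebra_simps)
    then show ?thesis by blast
  next
    assume e: "e = hedge t (int n)"
    define j where "j = nat (int n + 2 * int m - 2 - t)"
    have j: "t = int n + 2 * int m - 2 - int j" using t m by (simp add: j_def)
    have "2 * m \<le> Suc j" using t j by linarith
    then have "e = {out j, out (Suc j)}"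
      using j e by (cases "Suc j = 2 * m") (auto simp: out_def hedge_def insert_commute algebra_simps)
    moreover have "j \<in> {0..<4 * m - 2}" using t j m by auto
    ultimately show ?thesis by blast
  qed
qed

lemma closed_walk_tour: "closed_walk_edges tour = P \<union> K"
proof -
  have tour: "tour @ [hd tour] = body (m - 1) @ map out [1..<4 * m - 1]"
  proof -
    have "[1..<4 * m - 1] = [1..<4 * m - 2] @ [4 * m - 2]"
    proof -
      have "4 * m - 1 = Suc (4 * m - 2)" "1 \<le> 4 * m - 2" using m by simp_all
      then show ?thesis by (simp only: upt_Suc if_True)
    qed
    moreover have "out (4 * m - 2) = pos 0 N" using m by (auto simp: out_def pos_N)
    ultimately show ?thesis by (simp add: tour_def hd_body)
  qed
  have last: "last (body (m - 1)) = out 0"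
    using m by (simp add: last_body pos_N out_def of_nat_diff)
  have ne: "map out [1..<4 * m - 1] \<noteq> []" "hd (map out [1..<4 * m - 1]) = out 1"
    using m by (simp_all add: hd_map)
  have "tour \<noteq> []" by (simp add: tour_def)
  then have "closed_walk_edges tour = path_edges (body (m - 1)) \<union> {{out 0, out 1}} \<union> path_edges (map out [1..<4 * m - 1])"
    unfolding closed_walk_edges_path[OF \<open>tour \<noteq> []\<close>] tour path_edges_append[OF body_nonempty ne(1)] last ne(2) by simp
  also have "\<dots> = path_edges (body (m - 1)) \<union> (\<lambda>j. {out j, out (Suc j)}) ` {0..<4 * m - 2}"
  proof -
    have "{0..<4 * m - 2} = insert 0 {1..<4 * m - 1 - 1}" using m by auto
    then show ?thesis unfolding path_edges_map_upt by simp
  qed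
  also have "path_edges (body (m - 1)) = P
     \<union> (\<Union>i<m. {vedge (2 * int i + 1) (2 * int m - 2 * int i - 1), hedge (2 * int i + 1) (2 * int m - 2 * int i - 1)})
     \<union> (\<Union>i<m - 1. {hedge (int n - 2 * int m + 2 * int i + 2) (int n - 2 * int i - 1),
                   vedge (int n - 2 * int m + 2 * int i + 3) (int n - 2 * int i - 2)})"
  proof -
    have "2 * (m - 1) + 2 = 2 * m" "m - 1 + 1 = m" using m by auto
    moreover have "(\<Union>i<2 * m. path_edges (strand i)) = P"
      unfolding strand_def path_edges_map_upt P_def by force
    moreover have "{pos (2 * i) 0, ll i} = vedge (2 * int i + 1) (2 * int m - 2 * int i - 1)"
      "{ll i, pos (2 * i + 1) 0} = hedge (2 * int i + 1) (2 * int m - 2 * int i - 1)" for i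
      by (simp_all add: pos_def ll_def vedge_def hedge_def insert_commute algebra_simps)
    moreover have "{pos (2 * i + 1) N, ur i} = hedge (int n - 2 * int m + 2 * int i + 2) (int n - 2 * int i - 1)"
      "{ur i, pos (2 * i + 2) N} = vedge (int n - 2 * int m + 2 * int i + 3) (int n - 2 * int i - 2)" for i
      by (simp_all add: pos_N ur_def vedge_def hedge_def insert_commute algebra_simps)
    ultimately show ?thesis unfolding path_edges_body by simp
  qed
  finally show ?thesis unfolding out_edges K_def by (simp add: Un_assoc)
qed

lemma is_cycle_P_K:
  assumes "P \<union> K \<subseteq> grid_edges n n"
  shows "is_cycle (grid_edges n n) (P \<union> K)"
proof -
  have "3 \<le> length (body k)" for k
    by (induction k) (simp_all add: seg_def strand_def)
  then have "3 \<le> length tour" by (simp add: tour_def trans_le_add1)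
  then show ?thesis
    unfolding is_cycle_def using assms distinct_tour closed_walk_tour by (intro exI[of _ tour]) simp
qed

section \<open>Strand edges in coordinates\<close>

definition right_step :: "nat \<Rightarrow> bool" where "right_step j \<longleftrightarrow> j mod 4 \<in> {0, 3}"

lemma strand_edge:
  "{pos i j, pos i (Suc j)} = (if right_step j then hedge (fst (pos i j)) (snd (pos i j))
     else vedge (fst (pos i j)) (snd (pos i j)))"
  by (simp add: right_step_def pos_def hedge_def vedge_def algebra_simps)

lemma strand_edge_eq:
  "hedge x y = {pos i j, pos i (Suc j)} \<longleftrightarrow> (x, y) = pos i j \<and> right_step j"
  "vedge x y = {pos i j, pos i (Suc j)} \<longleftrightarrow> (x, y) = pos i j \<and> \<not> right_step j"
  unfolding strand_edge by (auto simp: prod_eq_iff split: if_splits)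

lemma P_iff: "e \<in> P \<longleftrightarrow> (\<exists>i j. i < 2 * m \<and> j < N \<and> e = {pos i j, pos i (Suc j)})"
  unfolding P_def by force

lemma P_cases:
  assumes "e \<in> P"
  obtains x y where "e = hedge x y" | x y where "e = vedge x y"
  using assms unfolding P_iff strand_edge by (metis (full_types))

text \<open>All strands step in the same direction at a given level, and level
  \<open>2 * m + 1 + j\<close> belongs to step \<open>j\<close>.\<close>

definition hor :: "int \<Rightarrow> bool" where "hor k \<longleftrightarrow> (k - 2 * int m - 1) mod 4 \<in> {0, 3}"

lemma hor_pos: "(x, y) = pos i j \<Longrightarrow> hor (x + y) \<longleftrightarrow> right_step j"
proof -
  assume "(x, y) = pos i j"
  then have "x + y - 2 * int m - 1 = int j" using pos_level[of i j] by (metis add_diff_cancel_left' diff_diff_eq fst_conv snd_conv)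
  moreover have "int j mod 4 = int (j mod 4)" by (simp add: zmod_int)
  ultimately show ?thesis by (simp add: hor_def right_step_def)
qed

lemma pos_diff:
  "fst (pos i j) - snd (pos i j)
    = 2 * int i + 1 - 2 * int m + (if j mod 4 = 1 then 1 else if j mod 4 = 3 then - 1 else 0)"
  using rho_mu_diff[of j] by (simp add: pos_def algebra_simps split del: if_split)

text \<open>The level determines \<open>j\<close>, and then \<open>x\<close> determines the strand.
  The bounds on \<open>x - y\<close> are lopsided because a strand is 0 or -1 off its diagonal
  before a step to the right, and 0 or 1 before a step up.\<close>

lemma pos_exists:
  assumes "2 * int m < x + y" "x + y \<le> 2 * int n - 2 * int m"
    and "if hor (x + y) then - 2 * int m \<le> x - y \<and> x - y < 2 * int m else - 2 * int m < x - y \<and> x - y \<le> 2 * int m"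
  obtains i j where "i < 2 * m" "j < N" "(x, y) = pos i j"
proof -
  define j where "j = nat (x + y - 2 * int m - 1)"
  have j: "int j = x + y - 2 * int m - 1" using assms(1) by (simp add: j_def)
  have jN: "j < N" using j assms(2) int_N by linarith
  have "int j mod 4 = int (j mod 4)" by (simp add: zmod_int)
  then have hor: "hor (x + y) \<longleftrightarrow> j mod 4 \<in> {0, 3}" unfolding hor_def j[symmetric] by simp
  define t where "t = x - 1 - int (rho j)"
  have y: "y = 2 * int m - t + int (mu j)" using j rho_mu[of j] by (simp add: t_def)
  have "2 * t = x - y + 2 * int m - 1 - (int (rho j) - int (mu j))" using y by (simp add: t_def)
  then have "0 \<le> t \<and> t < 2 * int m"
    using assms(3) unfolding hor rho_mu_diff by (auto split: if_splits)
  then have "(x, y) = pos (nat t) j" "nat t < 2 * m" using y by (auto simp: pos_def t_def)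
  then show thesis using that jN by blast
qed

text \<open>The strands fill a strip along the main diagonal: at each of their levels,
  \<open>P\<close> has all horizontal or all vertical edges of the strip.\<close>

lemma hedge_P: "hedge x y \<in> P \<longleftrightarrow> 2 * int m < x + y \<and> x + y \<le> 2 * int n - 2 * int m
    \<and> - 2 * int m \<le> x - y \<and> x - y < 2 * int m \<and> hor (x + y)"
proof -
  have "hedge x y \<in> P \<longleftrightarrow> (\<exists>i j. i < 2 * m \<and> j < N \<and> (x, y) = pos i j \<and> right_step j)"
    unfolding P_iff strand_edge_eq by blast
  also have "\<dots> \<longleftrightarrow> (\<exists>i j. i < 2 * m \<and> j < N \<and> (x, y) = pos i j) \<and> hor (x + y)"
    using hor_pos by blast
  also have "\<dots> \<longleftrightarrow> 2 * int m < x + y \<and> x + y \<le> 2 * int n - 2 * int m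
    \<and> - 2 * int m \<le> x - y \<and> x - y < 2 * int m \<and> hor (x + y)" (is "?A \<longleftrightarrow> ?B")
  proof
    assume ?A
    then obtain i j where ij: "i < 2 * m" "j < N" "(x, y) = pos i j" "hor (x + y)" by blast
    have "j mod 4 \<in> {0, 3}" using ij(4) hor_pos[OF ij(3)] by (simp only: right_step_def)
    then show ?B
      using ij pos_level[of i j] pos_diff[of i j] int_N by (auto simp flip: ij(3))
  next
    assume ?B
    then show ?A using pos_exists[of x y] by (metis (full_types))
  qed
  finally show ?thesis .
qed

lemma vedge_P: "vedge x y \<in> P \<longleftrightarrow> 2 * int m < x + y \<and> x + y \<le> 2 * int n - 2 * int m
    \<and> - 2 * int m < x - y \<and> x - y \<le> 2 * int m \<and> \<not> hor (x + y)"
proof -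
  have "vedge x y \<in> P \<longleftrightarrow> (\<exists>i j. i < 2 * m \<and> j < N \<and> (x, y) = pos i j \<and> \<not> right_step j)"
    unfolding P_iff strand_edge_eq by blast
  also have "\<dots> \<longleftrightarrow> (\<exists>i j. i < 2 * m \<and> j < N \<and> (x, y) = pos i j) \<and> \<not> hor (x + y)"
    using hor_pos by blast
  also have "\<dots> \<longleftrightarrow> 2 * int m < x + y \<and> x + y \<le> 2 * int n - 2 * int m
    \<and> - 2 * int m < x - y \<and> x - y \<le> 2 * int m \<and> \<not> hor (x + y)" (is "?A \<longleftrightarrow> ?B")
  proof
    assume ?A
    then obtain i j where ij: "i < 2 * m" "j < N" "(x, y) = pos i j" "\<not> hor (x + y)" by blast
    have "j mod 4 \<notin> {0, 3}" using ij(4) hor_pos[OF ij(3)] by (simp only: right_step_def) simp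
    then show ?B
      using ij pos_level[of i j] pos_diff[of i j] int_N by (auto simp flip: ij(3) split: if_splits)
  next
    assume ?B
    then show ?A using pos_exists[of x y] by (metis (full_types))
  qed
  finally show ?thesis .
qed

section \<open>Reflection in the main diagonal\<close>

definition mirror :: "point set set \<Rightarrow> point set set" where
  "mirror S = (`) prod.swap ` S"

lemma swap_edge: "prod.swap ` hedge x y = vedge y x" "prod.swap ` vedge x y = hedge y x"
  by (auto simp: hedge_def vedge_def)

lemma mem_mirror: "e \<in> mirror S \<longleftrightarrow> prod.swap ` e \<in> S"
proof -
  have swap: "prod.swap ` prod.swap ` e = e" for e :: "point set" by (simp add: image_image)
  show ?thesis
  proof
    assume "e \<in> mirror S"
    then show "prod.swap ` e \<in> S" using swap by (auto simp: mirror_def)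
  next
    assume "prod.swap ` e \<in> S"
    then have "prod.swap ` prod.swap ` e \<in> mirror S" unfolding mirror_def by (rule imageI)
    then show "e \<in> mirror S" by (simp only: swap)
  qed
qed

lemma hedge_mirror: "hedge x y \<in> mirror S \<longleftrightarrow> vedge y x \<in> S"
  and vedge_mirror: "vedge x y \<in> mirror S \<longleftrightarrow> hedge y x \<in> S"
  by (simp_all add: mem_mirror swap_edge)

lemma mirror_grid: "mirror (grid_edges n n) \<subseteq> grid_edges n n"
proof
  fix e assume "e \<in> mirror (grid_edges n n)"
  then obtain e' where e': "e' \<in> grid_edges n n" "e = prod.swap ` e'" by (auto simp: mirror_def)
  from e'(1) show "e \<in> grid_edges n n"
    by (cases rule: grid_edge_cases) (use e' in \<open>simp_all add: swap_edge\<close>)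
qed

lemma K_cases:
  assumes "e \<in> K"
  obtains i where "i < m" "e = vedge (2 * int i + 1) (2 * int m - 2 * int i - 1)
      \<or> e = hedge (2 * int i + 1) (2 * int m - 2 * int i - 1)"
  | i where "i < m - 1" "e = hedge (int n - 2 * int m + 2 * int i + 2) (int n - 2 * int i - 1)
      \<or> e = vedge (int n - 2 * int m + 2 * int i + 3) (int n - 2 * int i - 2)"
  | t where "int n - 2 * int m < t" "t < int n" "e = vedge (int n) t \<or> e = hedge t (int n)"
  using assms unfolding K_def by fastforce

lemma K_subset: "K \<subseteq> grid_edges n n"
proof
  fix e assume "e \<in> K"
  then show "e \<in> grid_edges n n"
    by (cases rule: K_cases) (use m in auto)
qed

text \<open>The reflection exchanges lower caps \<open>i\<close> and \<open>m - 1 - i\<close>, upper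
  caps \<open>i\<close> and \<open>m - 2 - i\<close>, and the two sides of the border path.\<close>

lemma mirror_K: "mirror K = K"
proof -
  have sub: "prod.swap ` e \<in> K" if "e \<in> K" for e
    using that
  proof (cases rule: K_cases)
    case (1 i)
    define i' where "i' = m - 1 - i"
    have i': "i' < m" "2 * int i + 1 = 2 * int m - 2 * int i' - 1" "2 * int m - 2 * int i - 1 = 2 * int i' + 1"
      using 1(1) by (auto simp: i'_def of_nat_diff)
    from 1(2) have "prod.swap ` e \<in> {vedge (2 * int i' + 1) (2 * int m - 2 * int i' - 1),
        hedge (2 * int i' + 1) (2 * int m - 2 * int i' - 1)}"
      unfolding i' by (elim disjE) (simp_all add: swap_edge)
    then show ?thesis using i'(1) unfolding K_def by blast
  next
    case (2 i)
    define i' where "i' = m - 2 - i"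
    have i': "i' < m - 1" "int i = int m - 2 - int i'"
      using 2(1) by (auto simp: i'_def of_nat_diff)
    from 2(2) have "prod.swap ` e \<in> {hedge (int n - 2 * int m + 2 * int i' + 2) (int n - 2 * int i' - 1),
        vedge (int n - 2 * int m + 2 * int i' + 3) (int n - 2 * int i' - 2)}"
      unfolding i'(2) by (elim disjE) (simp_all add: swap_edge algebra_simps)
    then show ?thesis using i'(1) unfolding K_def by blast
  next
    case (3 t)
    from 3(3) have "prod.swap ` e \<in> {vedge (int n) t, hedge t (int n)}"
      by (elim disjE) (simp_all add: swap_edge)
    moreover have "t \<in> {int n - 2 * int m + 1..<int n}" using 3 by simp
    ultimately have "prod.swap ` e \<in> (\<Union>t\<in>{int n - 2 * int m + 1..<int n}. {vedge (int n) t, hedge t (int n)})"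
      by (rule UN_I[rotated])
    then show ?thesis unfolding K_def by (rule UnI2)
  qed
  have "prod.swap ` prod.swap ` e = e" for e :: "point set" by (simp add: image_image)
  then show ?thesis using sub by (metis (no_types, lifting) mem_mirror subsetI subset_antisym)
qed

lemma hedge_K: "hedge x y \<in> K \<Longrightarrow> x + y = 2 * int m \<or> x + y > 2 * int n - 2 * int m"
  by (erule K_cases) auto

lemma vedge_K: "vedge x y \<in> K \<Longrightarrow> x + y = 2 * int m \<or> x + y > 2 * int n - 2 * int m"
  by (erule K_cases) auto

lemma P_subset: "P \<subseteq> grid_edges n n"
proof
  fix e assume e: "e \<in> P"
  then show "e \<in> grid_edges n n"
    by (cases rule: P_cases) (use e in \<open>auto simp: hedge_P vedge_P\<close>)
qed

lemma P_K_disjoint: "P \<inter> K = {}"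
proof -
  have False if "e \<in> P" "e \<in> K" for e
    using that(1)
    by (cases rule: P_cases) (use that hedge_K vedge_K in \<open>fastforce simp: hedge_P vedge_P\<close>)+
  then show ?thesis by blast
qed

text \<open>Reflection keeps \<open>x + y\<close> but exchanges horizontal and vertical, and each
  level of \<open>P\<close> has only one direction.\<close>

lemma P_mirror_disjoint: "P \<inter> mirror P = {}"
proof -
  have False if "e \<in> P" "e \<in> mirror P" for e
    using that(1)
    by (cases rule: P_cases)
      (use that in \<open>auto simp: hedge_P vedge_P hedge_mirror vedge_mirror add.commute\<close>)
  then show ?thesis by blast
qed

lemma mirror_P_K_disjoint: "mirror P \<inter> K = {}"
proof -
  have False if "e \<in> mirror P" "e \<in> K" for e
  proof -
    have "prod.swap ` e \<in> P" "prod.swap ` e \<in> K"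
      using that mirror_K mem_mirror by blast+
    then show False using P_K_disjoint by blast
  qed
  then show ?thesis by blast
qed

lemma card_P: "card P = 2 * m * N"
proof -
  have "inj_on (\<lambda>(i, j). {pos i j, pos i (Suc j)}) ({..<2 * m} \<times> {..<N})"
    by (rule inj_onI) (auto simp: doubleton_eq_iff)
  then show ?thesis by (simp add: P_def card_image)
qed

text \<open>The lower and left edges of the cell have level \<open>k\<close>, the other two level
  \<open>k + 1\<close>. Inside the strip each such pair gives one edge to \<open>P\<close> and one
  to \<open>mirror P\<close>; only cells on the rim of the strip, where \<open>a\<close> and
  \<open>b\<close> differ, need more care.\<close>

lemma cell_edges_mirror:
  assumes "0 < x" "x < int n" "0 < y" "y < int n"
  shows "card (cell_edges (x, y) \<inter> P) = card (cell_edges (x, y) \<inter> mirror P)"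
proof -
  define R where "R k \<longleftrightarrow> 2 * int m < k \<and> k \<le> 2 * int n - 2 * int m" for k
  define a where "a \<longleftrightarrow> - 2 * int m \<le> x - y \<and> x - y < 2 * int m"
  define b where "b \<longleftrightarrow> - 2 * int m < x - y \<and> x - y \<le> 2 * int m"
  define k where "k = x + y"
  have P: "hedge x y \<in> P \<longleftrightarrow> R k \<and> a \<and> hor k" "vedge x y \<in> P \<longleftrightarrow> R k \<and> b \<and> \<not> hor k"
    "hedge x (y + 1) \<in> P \<longleftrightarrow> R (k + 1) \<and> b \<and> hor (k + 1)"
    "vedge (x + 1) y \<in> P \<longleftrightarrow> R (k + 1) \<and> a \<and> \<not> hor (k + 1)"
    unfolding hedge_P vedge_P R_def a_def b_def k_def by (auto simp: algebra_simps)
  have T: "hedge x y \<in> mirror P \<longleftrightarrow> R k \<and> a \<and> \<not> hor k" "vedge x y \<in> mirror P \<longleftrightarrow> R k \<and> b \<and> hor k"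
    "hedge x (y + 1) \<in> mirror P \<longleftrightarrow> R (k + 1) \<and> b \<and> \<not> hor (k + 1)"
    "vedge (x + 1) y \<in> mirror P \<longleftrightarrow> R (k + 1) \<and> a \<and> hor (k + 1)"
    unfolding hedge_mirror vedge_mirror hedge_P vedge_P R_def a_def b_def k_def
    by (auto simp: algebra_simps)
  \<comment> \<open>On the rim \<open>k\<close> is even, and the pattern right, up, up, right gives
    levels \<open>k\<close> and \<open>k + 1\<close> the same direction; \<open>P\<close> and
    \<open>mirror P\<close> then each get one edge of the cell.\<close>
  have "R k \<and> R (k + 1) \<and> hor k = hor (k + 1)" if "a \<noteq> b"
  proof -
    have *: "x = y + 2 * int m \<or> y = x + 2 * int m" using that unfolding a_def b_def by auto
    then have "R k \<and> R (k + 1)" using assms unfolding R_def k_def by auto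
    moreover have "hor k = hor (k + 1)"
    proof -
      have "k - 2 * int m - 1 = 2 * y - 1 \<or> k - 2 * int m - 1 = 2 * x - 1"
        using * unfolding k_def by auto
      then obtain z where z: "k - 2 * int m - 1 = 2 * z - 1" by blast
      then have z': "k + 1 - 2 * int m - 1 = 2 * z" by simp
      show ?thesis unfolding hor_def z z' insert_iff empty_iff by presburger
    qed
    ultimately show ?thesis by blast
  qed
  then show ?thesis
    unfolding card_cell_edges_Int P T by (cases a; cases b) auto
qed

text \<open>The common part \<open>K\<close> drops out, leaving the disjoint sets \<open>P\<close>
  and \<open>mirror P\<close>; the size is \<open>4 s (n - s)\<close> for
  \<open>s = 2 m\<close>.\<close>

lemma size_mem: "8 * m * (n - 2 * m) \<in> difference_sizes n n"
proof -
  let ?C = "P \<union> K" and ?D = "mirror P \<union> K"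
  have C: "is_cycle (grid_edges n n) ?C"
    using is_cycle_P_K P_subset K_subset by blast
  have D_eq: "mirror ?C = ?D"
    using mirror_K by (simp add: mirror_def image_Un)
  have D: "is_cycle (grid_edges n n) ?D"
    using is_cycle_image[OF C, of prod.swap] mirror_grid D_eq by (simp add: mirror_def)
  have sig: "signature n n ?C = signature n n ?D"
  proof
    fix c :: point
    obtain x y where c: "c = (x, y)" by fastforce
    show "signature n n ?C c = signature n n ?D c"
    proof (cases "c \<in> grid_cells n n")
      case True
      have fin: "finite (cell_edges c)" by (simp add: c)
      have un: "card (cell_edges c \<inter> (S \<union> K)) = card (cell_edges c \<inter> S) + card (cell_edges c \<inter> K)"
        if "S \<inter> K = {}" for S
        using fin that by (subst Int_Un_distrib, subst card_Un_disjoint) auto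
      have "card (cell_edges c \<inter> P) = card (cell_edges c \<inter> mirror P)"
        using True unfolding c by (intro cell_edges_mirror) (auto simp: grid_cells_def)
      then show ?thesis
        using True un[OF P_K_disjoint] un[OF mirror_P_K_disjoint] by (simp add: signature_def)
    qed (simp add: signature_def)
  qed
  have fin: "finite P" using P_subset finite_subset finite_grid_edges by blast
  have "sym_diff ?C ?D = P \<union> mirror P"
    using P_K_disjoint mirror_P_K_disjoint P_mirror_disjoint by blast
  moreover have "card (P \<union> mirror P) = card P + card (mirror P)"
    using fin P_mirror_disjoint by (intro card_Un_disjoint) (auto simp: mirror_def)
  moreover have "card (mirror P) = card P"
    unfolding mirror_def by (intro card_image inj_on_image inj_on_subset[OF inj_swap, OF subset_UNIV])
  ultimately have "card (sym_diff ?C ?D) = 8 * m * (n - 2 * m)"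
    by (simp add: card_P N_def)
  then show ?thesis
    unfolding difference_sizes_def using C D sig
    by (intro CollectI exI[of _ ?C] exI[of _ ?D]) (simp only: simp_thms)
qed

end

theorem theorem6:
  fixes n :: nat
  assumes "n \<ge> 2"
  shows "is_greatest (difference_sizes n n) (n\<^sup>2 - delta n)
    \<and> delta n = (if odd n then 1 else if n mod 4 = 0 then 0 else 4)"
proof (intro conjI)
  show "delta n = (if odd n then 1 else if n mod 4 = 0 then 0 else 4)" by (rule delta_eq)
  have upper: "k \<le> n\<^sup>2 - delta n" if size: "k \<in> difference_sizes n n" for k
  proof -
    obtain C D where CD: "is_cycle (grid_edges n n) C" "is_cycle (grid_edges n n) D"
      "signature n n C = signature n n D" and k: "k = card (sym_diff C D)"
      using size unfolding difference_sizes_def by blast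
    obtain r r' where "region_of n C r" "region_of n D r'"
      using cycle_region[OF CD(1)] cycle_region[OF CD(2)] by metis
    then interpret same_signature n C D r r'
      using assms CD cycle_subset by unfold_locales
    show ?thesis unfolding k by (rule card_diff_le)
  qed
  \<comment> \<open>This makes \<open>2 * m\<close> an even number closest to \<open>n / 2\<close>:
    \<open>n - 4 * m\<close> is 0, 1, -2 or -1, and its square is \<open>delta n\<close>.\<close>
  define m where "m = (n + 2) div 4"
  interpret extremal n m
    by unfold_locales (use assms in \<open>auto simp: m_def\<close>)
  have "8 * m * (n - 2 * m) = n\<^sup>2 - delta n"
  proof -
    define q where "q = n div 4"
    consider "n = 4 * q" | "n = 4 * q + 1" | "n = 4 * q + 2" | "n = 4 * q + 3"
      unfolding q_def by linarith
    then have "n\<^sup>2 = 8 * m * (n - 2 * m) + delta n"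
    proof cases
      case 1
      then have "m = q" by (simp add: m_def)
      then have "n - 2 * m = 2 * q" "delta n = 0" using 1 by (simp_all add: delta_eq)
      then show ?thesis using 1 \<open>m = q\<close> by (simp add: power2_eq_square)
    next
      case 2
      then have "m = q" by (simp add: m_def)
      then have "n - 2 * m = 2 * q + 1" "delta n = 1" using 2 by (simp_all add: delta_eq)
      then show ?thesis using 2 \<open>m = q\<close> by (simp add: power2_eq_square algebra_simps)
    next
      case 3
      then have "m = q + 1" by (simp add: m_def)
      moreover have "n mod 4 = 2" using 3 by presburger
      ultimately have "n - 2 * m = 2 * q" "delta n = 4" using 3 by (simp_all add: delta_eq)
      then show ?thesis using 3 \<open>m = q + 1\<close> by (simp add: power2_eq_square algebra_simps)
    next
      case 4
      then have "m = q + 1" by (simp add: m_def)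
      then have "n - 2 * m = 2 * q + 1" "delta n = 1" using 4 by (simp_all add: delta_eq)
      then show ?thesis using 4 \<open>m = q + 1\<close> by (simp add: power2_eq_square algebra_simps)
    qed
    then show ?thesis by simp
  qed
  then show "is_greatest (difference_sizes n n) (n\<^sup>2 - delta n)"
    unfolding is_greatest_def using size_mem upper by auto
qed

end
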